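(* For all $h\ge2$, there exist $u_0,\dots,u_{h-2},v_0,\dots,v_{h-1},w_0,\dots,w_h\in\mathbb{Q}$ such that for all $L\ge0$, $$s(L,h)=\alpha L^2+\beta L+u_{L\bmod(h-1)}+v_{L\bmod h}+w_{L\bmod(h+1)},$$ with $$\alpha=\frac{1}{h(h^2-1)}\sum_{i=1}^{h-1}(h-i)\varphi(i)\qquad\text{and}\qquad\beta=\frac{1}{h(h+1)}\sum_{i=1}^{h}\varphi(i),$$ where $\varphi$ is Euler's totient function.
   Context: For a finite word $w$ over $\{0,1\}$, $|w|$ is its length and $|w|_0,|w|_1$ are its numbers of $0$'s and $1$'s; $|w|_1$ is the height of $w$. A subword means a contiguous factor. A word $w$ is balanced if for all finite subwords $u,v$ of $w$ with $|u|=|v|$ one has $\bigl||u|_0-|v|_0\bigr|\le 1$. For $0\le h\le L$, $\mathbb{S}(L,h)$ is the set of balanced words in $\{0,1\}^*$ of length $L$ and height $h$. The function $s:\mathbb{Z}^2\to\mathbb{N}$ is defined by $s(L,h)=\#\mathbb{S}(L,h\bmod L)$ if $L>0$ (with $h\bmod L\in\{0,\dots,L-1\}$), $s(0,0)=1$, and $s(L,h)=0$ if $L<0$ or if $L=0$ and $h\ne0$. Euler's totient satisfies $\varphi(1)=1$. *)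

theory Defs
  imports "HOL-Library.Sublist" "HOL-Number_Theory.Totient"
begin

text \<open>Words over the alphabet \<open>{0, 1}\<close> are the elements of \<open>lists {0, 1}\<close>;
  \<^const>\<open>sublist\<close> is the contiguous factor relation.\<close>

definition balanced :: "nat list \<Rightarrow> bool" where
  "balanced w \<longleftrightarrow>
     (\<forall>u v. sublist u w \<longrightarrow> sublist v w \<longrightarrow> length u = length v \<longrightarrow>
        \<bar>int (count_list u 0) - int (count_list v 0)\<bar> \<le> 1)"

definition balanced_words :: "nat \<Rightarrow> nat \<Rightarrow> nat list set" where
  "balanced_words L h =
     {w \<in> lists {0, 1}. balanced w \<and> length w = L \<and> count_list w 1 = h}"

definition num_balanced :: "int \<Rightarrow> int \<Rightarrow> nat" where
  "num_balanced L h =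
     (if L > 0 then card (balanced_words (nat L) (nat (h mod L)))
      else if L = 0 \<and> h = 0 then 1
      else 0)"

end

theory Submission
  imports Defs
begin

text \<open>A word with \<open>h = n + 1\<close> ones is a list of \<open>h + 1\<close> gaps, and it is balanced iff the \<open>n\<close> inner
  gaps are \<open>m - 1 + g\<^sub>i\<close> for a balanced word \<open>g\<close> of length \<open>n\<close> with at least one \<open>0\<close>, while the outer
  gaps \<open>a\<close>, \<open>b\<close> satisfy \<open>a < m + A\<close> and \<open>b < m + B\<close>, where \<open>A\<close> and \<open>B\<close> are \<open>1\<close> or \<open>0\<close> according to whether
  \<open>1 g\<close> and \<open>g 1\<close> are balanced. Hence \<open>s(L, h)\<close> is the sum over \<open>g\<close> of the number of triples
  \<open>(m, a, b)\<close> with these bounds and \<open>m n + \<bar>g\<bar>\<^sub>1 + 1 + a + b = L\<close>; for \<open>L < h\<close> only \<open>m = 0\<close> occurs,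
  and the exchange of length and height under passing to gaps identifies that term with
  \<open>s(L, h)\<close>. Inclusion-exclusion turns the number of triples into sums of the triangular
  function along progressions of step \<open>n\<close>, \<open>n + 1\<close> and \<open>n + 2\<close>, each of which is a quadratic
  polynomial plus a term of the corresponding period.

  The leading coefficients only involve the number of balanced words of length \<open>n\<close> and \<open>n + 1\<close>,
  because complementation determines the mean height and the means of \<open>A\<close> and \<open>B\<close>. Passing from
  length \<open>n\<close> to \<open>n + 1\<close> adds the number of left special words, which correspond to the Farey
  fractions of order \<open>n + 1\<close> in \<open>[0, 1)\<close>: shifted prefix sums of a left special word are
  superadditive up to an error of \<open>1\<close>, hence of the form \<open>\<lfloor>a p / q\<rfloor>\<close>.\<close>

section \<open>Balanced words and their gaps\<close>

abbreviation psum :: "nat list \<Rightarrow> nat \<Rightarrow> nat" where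
  "psum w i \<equiv> sum_list (take i w)"

text \<open>Balance for lists of arbitrary naturals: windows of equal length \<open>k\<close> have
  sums differing by at most 1. Window sums are differences of prefix sums, rearranged to avoid
  truncated subtraction; gap lists, which are not binary, need this generality.\<close>

definition evenly :: "nat list \<Rightarrow> bool" where
  "evenly w \<longleftrightarrow> (\<forall>i j k. i + k \<le> length w \<longrightarrow> j + k \<le> length w \<longrightarrow>
     psum w (i + k) + psum w j \<le> psum w (j + k) + psum w i + 1)"

lemma evenlyD:
  "evenly w \<Longrightarrow> i + k \<le> length w \<Longrightarrow> j + k \<le> length w \<Longrightarrow>
     psum w (i + k) + psum w j \<le> psum w (j + k) + psum w i + 1"
  unfolding evenly_def by blast

lemma psum_add: "psum w (i + k) = psum w i + sum_list (take k (drop i w))"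
  by (simp add: take_add)

lemma psum_mono: "i \<le> j \<Longrightarrow> psum w i \<le> psum w j"
  by (metis le_add1 le_iff_add psum_add)

lemma psum_le: "psum w i \<le> sum_list w"
  by (metis append_take_drop_id le_add1 sum_list_append)

lemma binary_sum_list:
  assumes "set w \<subseteq> {0, 1}"
  shows "count_list w 1 = sum_list w" "count_list w 0 + sum_list w = length w"
  using assms by (induction w) auto

lemma sublist_iff_take_drop:
  "sublist u w \<longleftrightarrow> (\<exists>i k. i + k \<le> length w \<and> u = take k (drop i w))"
proof
  assume "sublist u w"
  then obtain ps ss where "w = ps @ u @ ss" by (auto simp: sublist_def)
  then show "\<exists>i k. i + k \<le> length w \<and> u = take k (drop i w)"
    by (intro exI[of _ "length ps"] exI[of _ "length u"]) simp
next
  show "\<exists>i k. i + k \<le> length w \<and> u = take k (drop i w) \<Longrightarrow> sublist u w"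
    by (metis append_take_drop_id sublist_def)
qed

text \<open>In a window of a binary word the number of zeros is the length minus the sum, so windows
  of equal length deviate equally in zeros and in sums. Interchanging the two windows replaces the
  absolute value by a one-sided bound.\<close>

lemma balanced_iff_evenly:
  assumes "set w \<subseteq> {0, 1}"
  shows "balanced w \<longleftrightarrow> evenly w"
proof -
  have zeros: "int (count_list u 0) = int (length u) - int (sum_list u)"
    if "sublist u w" for u
    using binary_sum_list(2)[of u] set_mono_sublist[OF that] assms by force
  have window: "int (sum_list (take k (drop i w))) = int (psum w (i + k)) - int (psum w i)"
    for i k
    by (simp add: psum_add)
  have "balanced w \<longleftrightarrow> (\<forall>u v. sublist u w \<longrightarrow> sublist v w \<longrightarrow> length u = length v \<longrightarrow>
        sum_list u \<le> sum_list v + 1)"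
  proof
    assume bal: "balanced w"
    show "\<forall>u v. sublist u w \<longrightarrow> sublist v w \<longrightarrow> length u = length v \<longrightarrow>
        sum_list u \<le> sum_list v + 1"
    proof (intro allI impI)
      fix u v assume uv: "sublist u w" "sublist v w" "length u = length v"
      show "sum_list u \<le> sum_list v + 1"
        using bal[unfolded balanced_def, rule_format, OF uv] zeros[OF uv(1)] zeros[OF uv(2)] uv(3)
        by linarith
    qed
  next
    assume le: "\<forall>u v. sublist u w \<longrightarrow> sublist v w \<longrightarrow> length u = length v \<longrightarrow>
        sum_list u \<le> sum_list v + 1"
    show "balanced w"
      unfolding balanced_def
    proof (intro allI impI)
      fix u v assume uv: "sublist u w" "sublist v w" "length u = length v"
      show "\<bar>int (count_list u 0) - int (count_list v 0)\<bar> \<le> 1"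
        using le[rule_format, OF uv] le[rule_format, OF uv(2,1) uv(3)[symmetric]]
          zeros[OF uv(1)] zeros[OF uv(2)] uv(3)
        by linarith
    qed
  qed
  also have "\<dots> \<longleftrightarrow> evenly w"
  proof
    assume le: "\<forall>u v. sublist u w \<longrightarrow> sublist v w \<longrightarrow> length u = length v \<longrightarrow>
        sum_list u \<le> sum_list v + 1"
    show "evenly w"
      unfolding evenly_def
    proof (intro allI impI)
      fix i j k assume ijk: "i + k \<le> length w" "j + k \<le> length w"
      have "sum_list (take k (drop i w)) \<le> sum_list (take k (drop j w)) + 1"
        using ijk by (intro le[rule_format]) (auto simp: sublist_iff_take_drop)
      then show "psum w (i + k) + psum w j \<le> psum w (j + k) + psum w i + 1"
        by (simp add: psum_add)
    qed
  next
    assume ev: "evenly w"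
    show "\<forall>u v. sublist u w \<longrightarrow> sublist v w \<longrightarrow> length u = length v \<longrightarrow>
        sum_list u \<le> sum_list v + 1"
    proof (intro allI impI)
      fix u v assume uv: "sublist u w" "sublist v w" "length u = length v"
      obtain i k where u: "i + k \<le> length w" "u = take k (drop i w)"
        using uv(1) by (auto simp: sublist_iff_take_drop)
      obtain j l where v: "j + l \<le> length w" "v = take l (drop j w)"
        using uv(2) by (auto simp: sublist_iff_take_drop)
      have "k = l" using u v uv(3) by simp
      then show "sum_list u \<le> sum_list v + 1"
        using evenlyD[OF ev, of i k j] u v by (simp add: psum_add)
    qed
  qed
  finally show ?thesis .
qed

definition binaries :: "nat \<Rightarrow> nat list set" where
  "binaries n = {w. set w \<subseteq> {0, 1} \<and> length w = n}"

definition even_words :: "nat \<Rightarrow> nat list set" where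
  "even_words n = {w \<in> binaries n. evenly w}"

lemma finite_binaries: "finite (binaries n)"
  unfolding binaries_def by (rule finite_lists_length_eq) simp

lemma finite_even_words: "finite (even_words n)"
  unfolding even_words_def using finite_binaries by simp

lemma balanced_words_eq:
  "balanced_words L h = {w \<in> even_words L. sum_list w = h}"
  unfolding balanced_words_def even_words_def binaries_def in_lists_conv_set
  using balanced_iff_evenly binary_sum_list(1) by (auto simp: subset_iff)

lemma psum_Suc_le: "set w \<subseteq> {0, 1} \<Longrightarrow> psum w (Suc i) \<le> psum w i + 1"
  by (induction w arbitrary: i) (auto simp: take_Cons split: nat.splits)

text \<open>A word is encoded by the lengths of its runs of zeros before, between and after its ones.\<close>

primrec dec :: "nat list \<Rightarrow> nat list" where
  "dec [] = []"
| "dec (c # cs) = replicate c 0 @ (if cs = [] then [] else 1 # dec cs)"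

primrec enc :: "nat list \<Rightarrow> nat list" where
  "enc [] = [0]"
| "enc (x # w) = (if x = 0 then Suc (hd (enc w)) # tl (enc w) else 0 # enc w)"

lemma enc_not_Nil [simp]: "enc w \<noteq> []"
  by (cases w) auto

lemma enc_replicate_append:
  "enc (replicate c 0 @ w) = (c + hd (enc w)) # tl (enc w)"
  by (induction c) auto

lemma enc_dec: "cs \<noteq> [] \<Longrightarrow> enc (dec cs) = cs"
  by (induction cs) (auto simp: enc_replicate_append)

lemma dec_enc: "set w \<subseteq> {0, 1} \<Longrightarrow> dec (enc w) = w"
proof (induction w)
  case (Cons x w)
  then show ?case
    by (cases "enc w") auto
qed simp

lemma length_enc: "set w \<subseteq> {0, 1} \<Longrightarrow> length (enc w) = Suc (sum_list w)"
  by (induction w) auto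

lemma enc_snoc: "enc (w @ [1]) = enc w @ [0]"
  by (induction w) auto

lemma set_dec: "set (dec cs) \<subseteq> {0, 1}"
  by (induction cs) auto

lemma sum_list_dec: "sum_list (dec cs) = length cs - 1"
  by (induction cs) (auto simp: sum_list_replicate)

lemma length_dec: "length (dec cs) = sum_list cs + (length cs - 1)"
  by (induction cs) auto

text \<open>The \<open>i\<close>-th one stands at position \<open>i + psum cs i\<close>, counted
  from 1. This Galois connection between counting ones and locating them transfers inequalities
  between a word and its gaps.\<close>

lemma le_psum_dec:
  assumes "i < length cs" "x \<le> length (dec cs)"
  shows "i \<le> psum (dec cs) x \<longleftrightarrow> i + psum cs i \<le> x"
  using assms
proof (induction cs arbitrary: i x)
  case (Cons c cs)
  show ?case
  proof (cases i)
    case (Suc i')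
    with Cons.prems have ne: "cs \<noteq> []" and i': "i' < length cs" by auto
    show ?thesis
    proof (cases "x \<le> c")
      case True
      then show ?thesis using Suc ne by (auto simp: sum_list_replicate)
    next
      case False
      then obtain y where y: "x = c + Suc y"
        by (metis add_Suc_right less_imp_Suc_add not_le)
      have "y \<le> length (dec cs)" using Cons.prems y ne by simp
      then show ?thesis using Cons.IH[OF i'] y Suc ne
        by (simp add: sum_list_replicate)
    qed
  qed simp
qed simp

text \<open>Balance of a word read off from its gaps: the outer gaps are truncated, so windows
  touching an end are only bounded from above.\<close>

definition gap_even :: "nat list \<Rightarrow> bool" where
  "gap_even cs \<longleftrightarrow> (\<forall>i j k. i + k \<le> length cs \<longrightarrow> 1 \<le> j \<longrightarrow> j + k < length cs \<longrightarrow>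
     psum cs (i + k) + psum cs j \<le> psum cs (j + k) + psum cs i + 1)"

text \<open>Windows of the word are matched with blocks of consecutive gaps: a block that is too
  long surrounds a window with too few ones, and a block that is too short lies inside an equally
  long window with too many.\<close>

lemma evenly_dec_iff:
  assumes "cs \<noteq> []"
  shows "evenly (dec cs) \<longleftrightarrow> gap_even cs"
proof -
  define h where "h = length cs - 1"
  have len: "length cs = Suc h" using assms by (simp add: h_def)
  \<comment> \<open>The position of the \<open>i\<close>-th one; \<open>P 0 = 0\<close> and
    \<open>P (Suc h)\<close>, one past the last letter, act as virtual ones delimiting the outer
    gaps.\<close>
  define P where "P i = i + psum cs i" for i
  have P_mono: "P i \<le> P j" if "i \<le> j" for i j
    using psum_mono[OF that, of cs] that by (simp add: P_def)
  have P_top: "P (Suc h) = Suc (length (dec cs))"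
    by (simp add: P_def len length_dec)
  have gal: "i \<le> psum (dec cs) x \<longleftrightarrow> P i \<le> x" if "i \<le> h" "x \<le> length (dec cs)" for i x
    using le_psum_dec[of i cs x] that by (simp add: P_def len)
  have psum_h: "psum (dec cs) x \<le> h" for x
    using psum_le[of x "dec cs"] by (simp add: sum_list_dec h_def)
  have gal': "P (Suc i) > x" if "psum (dec cs) x \<le> i" "i \<le> h" "x \<le> length (dec cs)" for i x
  proof (cases "i = h")
    case True
    then show ?thesis using that P_top by simp
  next
    case False
    then show ?thesis using gal[of "Suc i" x] that by linarith
  qed
  show ?thesis
  proof
    assume ev: "evenly (dec cs)"
    show "gap_even cs"
      unfolding gap_even_def
    proof (intro allI impI)
      fix i j k assume ijk: "i + k \<le> length cs" "1 \<le> j" "j + k < length cs"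
      show "psum cs (i + k) + psum cs j \<le> psum cs (j + k) + psum cs i + 1"
      proof (rule ccontr)
        assume "\<not> ?thesis"
        then have gt: "P (i + k) + P j \<ge> P (j + k) + P i + 2" by (simp add: P_def)
        have "k \<ge> 1" using gt by (cases k) auto
        then have ih: "i \<le> h" "i + k \<le> Suc h" "j + k \<le> h" using ijk len by auto
        have Pj: "1 \<le> P j" using ijk by (simp add: P_def)
        have "P j \<le> P (j + k)" by (rule P_mono) simp
        \<comment> \<open>The length of the window from the \<open>j\<close>-th to the
          \<open>(j + k)\<close>-th one inclusive, with \<open>k + 1\<close> ones. Because of the
          excess of 2, a window of this length also fits strictly between \<open>P i\<close> and
          \<open>P (i + k)\<close>, where it has at most \<open>k - 1\<close> ones.\<close>
        define l where "l = P (j + k) + 1 - P j"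
        have l: "P j - 1 + l = P (j + k)" "P i + l < P (i + k)"
          using Pj gt \<open>P j \<le> P (j + k)\<close> by (auto simp: l_def)
        have "P (i + k) \<le> Suc (length (dec cs))" using P_mono[OF ih(2)] P_top by simp
        then have il: "P i + l \<le> length (dec cs)" using l by simp
        have "P (j + k) < P (Suc h)"
          using psum_mono[of "j+k" "Suc h" cs] ih by (simp add: P_def)
        then have jl: "P j - 1 + l \<le> length (dec cs)" using P_top l by simp
        have 1: "i \<le> psum (dec cs) (P i)" using gal[of i "P i"] ih il by simp
        have 2: "j + k \<le> psum (dec cs) (P j - 1 + l)" using gal[of "j + k" "P (j + k)"] ih jl l by simp
        have 3: "psum (dec cs) (P j - 1) < j" using gal[of j "P j - 1"] ih jl Pj by linarith
        have 4: "psum (dec cs) (P i + l) < i + k"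
        proof (cases "i + k \<le> h")
          case True
          then show ?thesis using gal[of "i + k" "P i + l"] il l by simp
        next
          case False
          then show ?thesis using psum_h[of "P i + l"] ih by simp
        qed
        show False using evenlyD[OF ev jl il] 1 2 3 4 by simp
      qed
    qed
  next
    assume ge: "gap_even cs"
    show "evenly (dec cs)"
      unfolding evenly_def
    proof (intro allI impI)
      fix s t l assume stl: "s + l \<le> length (dec cs)" "t + l \<le> length (dec cs)"
      show "psum (dec cs) (s + l) + psum (dec cs) t \<le> psum (dec cs) (t + l) + psum (dec cs) s + 1"
      proof (rule ccontr)
        assume no: "\<not> ?thesis"
        \<comment> \<open>The light window, at \<open>t\<close>, has \<open>c\<close> ones and lies
          strictly between the possibly virtual ones \<open>i\<close> and \<open>i + c + 1\<close>;
          the heavy one, at \<open>s\<close>, contains the ones \<open>j + 1\<close> to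
          \<open>j + c + 2\<close>. This compares the blocks of \<open>c + 1\<close> gaps from
          \<open>i\<close> and from \<open>j + 1\<close>, the latter being inner.\<close>
        define i where "i = psum (dec cs) t"
        define c where "c = psum (dec cs) (t + l) - i"
        define j where "j = psum (dec cs) s"
        have "i \<le> psum (dec cs) (t + l)" unfolding i_def by (rule psum_mono) simp
        then have ic: "psum (dec cs) (t + l) = i + c" by (simp add: c_def)
        have jc: "psum (dec cs) (s + l) \<ge> j + c + 2" using no ic by (simp add: i_def j_def)
        have le: "i + c \<le> h" "j + c + 2 \<le> h" "i \<le> h"
          using psum_h[of "t + l"] psum_h[of "s + l"] ic jc by auto
        have 1: "P i \<le> t" using gal[of i t] le stl by (simp add: i_def)
        have 2: "P (Suc (i + c)) > t + l" using gal'[of "t + l" "i + c"] le stl ic by simp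
        have 3: "P (Suc j) > s" using gal'[of s j] le stl by (simp add: j_def)
        have 4: "P (j + c + 2) \<le> s + l" using gal[of "j + c + 2" "s + l"] le stl jc by simp
        have "psum cs (i + Suc c) + psum cs (Suc j) \<le> psum cs (Suc j + Suc c) + psum cs i + 1"
          using ge[unfolded gap_even_def, rule_format, of i "Suc c" "Suc j"] le by (simp add: len)
        then have "P (Suc (i + c)) + P (Suc j) \<le> P (j + c + 2) + P i + 1"
          by (simp add: P_def)
        then show False using 1 2 3 4 by simp
      qed
    qed
  qed
qed

section \<open>Shifted gap sequences\<close>

text \<open>Only the prefixes of \<open>1 # g\<close> are new windows. They are never too light:
  dropping the leading 1 and the last letter of the other window leaves a comparison inside
  \<open>g\<close>. What remains is superadditivity of \<open>H a = psum g (a - 1)\<close>.\<close>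

lemma evenly_Cons_one_iff:
  assumes "set g \<subseteq> {0, 1}" "evenly g"
  shows "evenly (1 # g) \<longleftrightarrow>
    (\<forall>j k. j + Suc k \<le> length g \<longrightarrow> psum g k + psum g j \<le> psum g (j + Suc k))" (is "_ \<longleftrightarrow> ?R")
proof
  assume ev: "evenly (1 # g)"
  show ?R
  proof (intro allI impI)
    fix j k assume "j + Suc k \<le> length g"
    then show "psum g k + psum g j \<le> psum g (j + Suc k)"
      using evenlyD[OF ev, of 0 "Suc k" "Suc j"] by simp
  qed
next
  assume R: ?R
  show "evenly (1 # g)"
    unfolding evenly_def
  proof (intro allI impI)
    fix i j k assume ijk: "i + k \<le> length (1 # g)" "j + k \<le> length (1 # g)"
    show "psum (1 # g) (i + k) + psum (1 # g) j \<le> psum (1 # g) (j + k) + psum (1 # g) i + 1"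
    proof (cases k)
      case (Suc k')
      show ?thesis
      proof (cases i; cases j)
        fix j' assume "i = 0" "j = Suc j'"
        then show ?thesis using R[rule_format, of j' k'] Suc ijk by simp
      next
        fix i' assume "i = Suc i'" "j = 0"
        moreover have "psum g (i' + k') \<le> psum g k' + psum g i' + 1" if "i' + k' \<le> length g"
          using evenlyD[OF assms(2), of i' k' 0] that by simp
        moreover have "psum g (Suc (i' + k')) \<le> psum g (i' + k') + 1"
          by (rule psum_Suc_le[OF assms(1)])
        ultimately show ?thesis using Suc ijk by simp
      next
        fix i' j' assume "i = Suc i'" "j = Suc j'"
        then show ?thesis using evenlyD[OF assms(2), of i' k j'] ijk by simp
      qed (use Suc in simp)
    qed simp
  qed
qed

text \<open>The mirror image: \<open>i + k = length g\<close> singles out the suffixes of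
  \<open>g\<close>, which the appended 1 completes to the new windows.\<close>

lemma evenly_snoc_one_iff:
  assumes "set g \<subseteq> {0, 1}" "evenly g"
  shows "evenly (g @ [1]) \<longleftrightarrow>
    (\<forall>i j k. i + k = length g \<longrightarrow> j + Suc k \<le> length g \<longrightarrow>
       sum_list g + psum g j \<le> psum g (j + Suc k) + psum g i)" (is "_ \<longleftrightarrow> ?R")
proof
  assume ev: "evenly (g @ [1])"
  show ?R
  proof (intro allI impI)
    fix i j k assume "i + k = length g" "j + Suc k \<le> length g"
    then show "sum_list g + psum g j \<le> psum g (j + Suc k) + psum g i"
      using evenlyD[OF ev, of i "Suc k" j] by simp
  qed
next
  assume R: ?R
  show "evenly (g @ [1])"
    unfolding evenly_def
  proof (intro allI impI)
    fix i j k assume ijk: "i + k \<le> length (g @ [1])" "j + k \<le> length (g @ [1])"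
    show "psum (g @ [1]) (i + k) + psum (g @ [1]) j
        \<le> psum (g @ [1]) (j + k) + psum (g @ [1]) i + 1"
    proof (cases k)
      case (Suc k')
      consider "i + k \<le> length g" "j + k \<le> length g"
        | "i + k = Suc (length g)" "j + k \<le> length g"
        | "i + k \<le> length g" "j + k = Suc (length g)"
        | "i = j"
        using ijk by fastforce
      then show ?thesis
      proof cases
        case 1
        then show ?thesis using evenlyD[OF assms(2), of i k j] by simp
      next
        case 2
        then show ?thesis using R[rule_format, of i k' j] Suc by simp
      next
        case 3
        then have "psum g (i + k') + psum g j \<le> psum g (j + k') + psum g i + 1"
          using Suc by (intro evenlyD[OF assms(2)]) auto
        moreover have "psum g (Suc (i + k')) \<le> psum g (i + k') + 1"
          by (rule psum_Suc_le[OF assms(1)])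
        moreover have "j + k' = length g" using 3 Suc by simp
        ultimately show ?thesis using Suc 3 by simp
      qed simp
    qed simp
  qed
qed

text \<open>The outer gaps occur only on the larger side, so they are only bounded from above. They
  never occur together, since no inner window is as long as the whole list; hence the conditions on
  \<open>a\<close> and \<open>b\<close> are independent.\<close>

lemma gap_even_iff:
  "gap_even (a # c @ [b]) \<longleftrightarrow> evenly c \<and>
    (\<forall>j k. j + Suc k \<le> length c \<longrightarrow> a + psum c k + psum c j \<le> psum c (j + Suc k) + 1) \<and>
    (\<forall>i j k. i + k = length c \<longrightarrow> j + Suc k \<le> length c \<longrightarrow>
       b + sum_list c + psum c j \<le> psum c (j + Suc k) + psum c i + 1)"
  (is "gap_even ?cs \<longleftrightarrow> ?E \<and> ?A \<and> ?B")
proof (intro iffI conjI)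
  assume ge: "gap_even ?cs"
  show ?E
    unfolding evenly_def
  proof (intro allI impI)
    fix i j k assume "i + k \<le> length c" "j + k \<le> length c"
    then show "psum c (i + k) + psum c j \<le> psum c (j + k) + psum c i + 1"
      using ge[unfolded gap_even_def, rule_format, of "Suc i" k "Suc j"] by simp
  qed
  show ?A
  proof (intro allI impI)
    fix j k assume "j + Suc k \<le> length c"
    then show "a + psum c k + psum c j \<le> psum c (j + Suc k) + 1"
      using ge[unfolded gap_even_def, rule_format, of 0 "Suc k" "Suc j"] by simp
  qed
  show ?B
  proof (intro allI impI)
    fix i j k assume "i + k = length c" "j + Suc k \<le> length c"
    then show "b + sum_list c + psum c j \<le> psum c (j + Suc k) + psum c i + 1"
      using ge[unfolded gap_even_def, rule_format, of "Suc i" "Suc k" "Suc j"] by simp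
  qed
next
  assume *: "?E \<and> ?A \<and> ?B"
  show "gap_even ?cs"
    unfolding gap_even_def
  proof (intro allI impI)
    fix i j k assume ijk: "i + k \<le> length ?cs" "1 \<le> j" "j + k < length ?cs"
    obtain j' where j: "j = Suc j'" using ijk by (cases j) auto
    show "psum ?cs (i + k) + psum ?cs j \<le> psum ?cs (j + k) + psum ?cs i + 1"
    proof (cases k)
      case (Suc k')
      show ?thesis
      proof (cases i)
        case 0
        have "a + psum c k' + psum c j' \<le> psum c (j' + Suc k') + 1"
          using * ijk j Suc by auto
        then show ?thesis using 0 Suc ijk j by simp
      next
        case i: (Suc i')
        show ?thesis
        proof (cases "i' + k \<le> length c")
          case True
          then show ?thesis using evenlyD[of c i' k j'] * ijk i j by simp
        next
          case False
          then have "i' + k' = length c" using ijk i Suc by simp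
          moreover have "j' + Suc k' \<le> length c" using ijk j Suc by simp
          ultimately have "b + sum_list c + psum c j' \<le> psum c (j' + Suc k') + psum c i' + 1"
            using * by blast
          then show ?thesis using \<open>i' + k' = length c\<close> Suc i j ijk by simp
        qed
      qed
    qed simp
  qed
qed

lemma psum_map_add: "i \<le> length g \<Longrightarrow> psum (map ((+) m) g) i = m * i + psum g i"
proof (induction g arbitrary: i)
  case (Cons x g)
  then show ?case by (cases i) auto
qed simp

lemma sum_list_map_add: "sum_list (map ((+) m) g) = m * length g + sum_list (g :: nat list)"
  by (induction g) auto

lemma evenly_map_add: "evenly (map ((+) m) g) \<longleftrightarrow> evenly g"
  unfolding evenly_def by (auto simp: psum_map_add algebra_simps)

text \<open>Windows of length 1 show that the entries take at most two consecutive values.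
  Subtracting the minimum leaves a binary word with a letter 0, the normalisation that makes the
  shift unique.\<close>

lemma evenly_imp_shifted_binary:
  assumes "evenly c" "c \<noteq> []"
  obtains m g where "c = map ((+) m) g" "g \<in> even_words (length c)" "sum_list g < length c"
proof -
  define m where "m = Min (set c)"
  define g where "g = map (\<lambda>x. x - m) c"
  have min: "m \<in> set c" "\<And>x. x \<in> set c \<Longrightarrow> m \<le> x"
    unfolding m_def using assms(2) by auto
  have c: "c = map ((+) m) g"
    unfolding g_def using min(2) by (simp add: map_idI)
  have "c ! i \<le> c ! j + 1" if "i < length c" "j < length c" for i j
    using evenlyD[OF assms(1), of i 1 j] that by (simp add: take_Suc_conv_app_nth)
  then have "x \<le> m + 1" if "x \<in> set c" for x
    using that min(1) by (metis in_set_conv_nth)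
  then have "set g \<subseteq> {0, 1}"
    unfolding g_def by fastforce
  moreover have "evenly g" using assms(1) c evenly_map_add by metis
  moreover have "length g = length c" by (simp add: g_def)
  moreover have "sum_list g < length c"
  proof -
    have 0: "0 \<in> set g" unfolding g_def using min(1) by force
    have "sum_list g < length g" if "set g \<subseteq> {0, 1}" "0 \<in> set g" for g :: "nat list"
      using that
    proof (induction g)
      case (Cons x g)
      have "sum_list g \<le> length g" using binary_sum_list(2)[of g] Cons.prems by simp
      then show ?case using Cons by auto
    qed simp
    then show ?thesis using 0 \<open>set g \<subseteq> {0, 1}\<close> \<open>length g = length c\<close> by metis
  qed
  ultimately show thesis
    by (intro that[OF c]) (auto simp: even_words_def binaries_def)
qed

lemma ex_zero_letter:
  assumes "sum_list g < length g"
  obtains j where "Suc j \<le> length g" "psum g (Suc j) = psum g j"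
proof -
  have "\<exists>j. Suc j \<le> length g \<and> psum g (Suc j) = psum g j"
    using assms
  proof (induction g)
    case (Cons x g)
    show ?case
    proof (cases "x = 0")
      case True
      then show ?thesis by (intro exI[of _ 0]) simp
    next
      case False
      then obtain j where "Suc j \<le> length g" "psum g (Suc j) = psum g j"
        using Cons by auto
      then show ?thesis by (intro exI[of _ "Suc j"]) simp
    qed
  qed simp
  then show thesis using that by blast
qed

abbreviation lext :: "nat list \<Rightarrow> nat" where
  "lext g \<equiv> of_bool (evenly (1 # g))"

abbreviation rext :: "nat list \<Rightarrow> nat" where
  "rext g \<equiv> of_bool (evenly (g @ [1]))"

text \<open>In \<open>gap_even_iff\<close> the inner window has one shifted gap more than its
  competitor, which contributes \<open>m\<close>. So \<open>a\<close> and \<open>b\<close> are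
  bounded by \<open>m + 1\<close> plus the minimum of an expression in \<open>g\<close>. Balance of
  \<open>g\<close> keeps this minimum at least -1, a letter 0 keeps it at most 0, and it is 0
  exactly if the extension of \<open>g\<close> by 1 on that side is balanced.\<close>

lemma evenly_dec_shifted_iff:
  assumes "g \<in> binaries n" "sum_list g < n"
  shows "evenly (dec (a # map ((+) m) g @ [b])) \<longleftrightarrow>
           evenly g \<and> a \<le> m + lext g \<and> b \<le> m + rext g"
proof (cases "evenly g")
  case ev: True
  define c where "c = map ((+) m) g"
  have g: "set g \<subseteq> {0, 1}" "length g = n" using assms(1) by (auto simp: binaries_def)
  obtain z where z: "Suc z \<le> n" "psum g (Suc z) = psum g z"
    using ex_zero_letter[of g] assms g by blast
  have psc: "psum c i = m * i + psum g i" if "i \<le> n" for i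
    unfolding c_def using psum_map_add[of i g m] that g by simp
  have A: "(\<forall>j k. j + Suc k \<le> n \<longrightarrow> a + psum c k + psum c j \<le> psum c (j + Suc k) + 1) \<longleftrightarrow>
      a \<le> m + lext g" (is "?A \<longleftrightarrow> _")
  proof -
    have A': "?A \<longleftrightarrow> (\<forall>j k. j + Suc k \<le> n \<longrightarrow>
        a + psum g k + psum g j \<le> m + psum g (j + Suc k) + 1)"
      by (auto simp: psc algebra_simps)
    have weak: "psum g k + psum g j \<le> psum g (j + Suc k) + 1" if "j + Suc k \<le> n" for j k
      using evenlyD[OF ev, of 0 k j] psum_mono[of "j + k" "j + Suc k" g] that g by simp
    show ?thesis
    proof (cases "evenly (1 # g)")
      case True
      have strong: "psum g k + psum g j \<le> psum g (j + Suc k)" if "j + Suc k \<le> n" for j k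
        using True that evenly_Cons_one_iff[OF g(1) ev] g(2) by blast
      show ?thesis
      proof
        assume ?A
        then have "a + psum g 0 + psum g z \<le> m + psum g (z + Suc 0) + 1"
          unfolding A' using z(1) by (metis add.commute plus_1_eq_Suc One_nat_def)
        then show "a \<le> m + lext g" using z True by simp
      next
        assume "a \<le> m + lext g"
        then show ?A unfolding A' using strong True by (fastforce simp: algebra_simps)
      qed
    next
      case False
      then obtain j k where jk: "j + Suc k \<le> n" "psum g k + psum g j > psum g (j + Suc k)"
        using evenly_Cons_one_iff[OF g(1) ev] g(2) by (meson not_le)
      show ?thesis
      proof
        assume ?A
        then have "a + psum g k + psum g j \<le> m + psum g (j + Suc k) + 1"
          unfolding A' using jk by blast
        then show "a \<le> m + lext g" using jk by simp
      next
        assume "a \<le> m + lext g"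
        then have "a \<le> m" using False by simp
        then show ?A unfolding A' using weak by (fastforce simp: algebra_simps)
      qed
    qed
  qed
  have B: "(\<forall>i j k. i + k = n \<longrightarrow> j + Suc k \<le> n \<longrightarrow>
      b + sum_list c + psum c j \<le> psum c (j + Suc k) + psum c i + 1) \<longleftrightarrow>
      b \<le> m + rext g" (is "?B \<longleftrightarrow> _")
  proof -
    have sc: "sum_list c = m * n + sum_list g"
      using sum_list_map_add[of m g] g by (simp add: c_def)
    have B': "?B \<longleftrightarrow> (\<forall>i j k. i + k = n \<longrightarrow> j + Suc k \<le> n \<longrightarrow>
        b + sum_list g + psum g j \<le> m + psum g (j + Suc k) + psum g i + 1)"
    proof -
      have "b + sum_list c + psum c j \<le> psum c (j + Suc k) + psum c i + 1 \<longleftrightarrow>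
          b + sum_list g + psum g j \<le> m + psum g (j + Suc k) + psum g i + 1"
        if "i + k = n" "j + Suc k \<le> n" for i j k
      proof -
        have "m * n = m * i + m * k" using that by (auto simp: algebra_simps)
        then show ?thesis using that by (simp add: psc sc algebra_simps)
      qed
      then show ?thesis by blast
    qed
    have weak: "sum_list g + psum g j \<le> psum g (j + Suc k) + psum g i + 1"
      if "i + k = n" "j + Suc k \<le> n" for i j k
      using evenlyD[OF ev, of i k j] psum_mono[of "j + k" "j + Suc k" g] that g by simp
    show ?thesis
    proof (cases "evenly (g @ [1])")
      case True
      have strong: "sum_list g + psum g j \<le> psum g (j + Suc k) + psum g i"
        if "i + k = n" "j + Suc k \<le> n" for i j k
        using iffD1[OF evenly_snoc_one_iff[OF g(1) ev] True] that g(2) by simp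
      show ?thesis
      proof
        assume ?B
        then have "b + sum_list g + psum g z \<le> m + psum g (z + Suc 0) + psum g n + 1"
          unfolding B' using z(1) by (metis add.commute add_0 plus_1_eq_Suc One_nat_def)
        then show "b \<le> m + rext g" using z True g by simp
      next
        assume "b \<le> m + rext g"
        then show ?B unfolding B' using strong True by (fastforce simp: algebra_simps)
      qed
    next
      case False
      then obtain i j k where ijk: "i + k = n" "j + Suc k \<le> n"
          "sum_list g + psum g j > psum g (j + Suc k) + psum g i"
        using evenly_snoc_one_iff[OF g(1) ev] g(2) by (meson not_le)
      show ?thesis
      proof
        assume ?B
        then have "b + sum_list g + psum g j \<le> m + psum g (j + Suc k) + psum g i + 1"
          unfolding B' using ijk by blast
        then show "b \<le> m + rext g" using ijk by simp
      next
        assume "b \<le> m + rext g"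
        then have "b \<le> m" using False by simp
        then show ?B unfolding B' using weak by (fastforce simp: algebra_simps)
      qed
    qed
  qed
  have "evenly c" using ev by (simp add: c_def evenly_map_add)
  moreover have "length c = n" using g by (simp add: c_def)
  ultimately have "gap_even (a # c @ [b]) \<longleftrightarrow> a \<le> m + lext g \<and> b \<le> m + rext g"
    unfolding gap_even_iff using A B by metis
  then show ?thesis
    using ev evenly_dec_iff[of "a # c @ [b]"] by (simp del: dec.simps flip: c_def)
next
  case False
  then have "\<not> gap_even (a # map ((+) m) g @ [b])" by (simp add: gap_even_iff evenly_map_add)
  then show ?thesis
    using False evenly_dec_iff[of "a # map ((+) m) g @ [b]"] by (simp del: dec.simps)
qed

section \<open>Counting by gap sequences\<close>

definition flip_word :: "nat list \<Rightarrow> nat list" where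
  "flip_word w = map (\<lambda>x. 1 - x) w"

lemma flip_word_flip_word: "set w \<subseteq> {0, 1} \<Longrightarrow> flip_word (flip_word w) = w"
  unfolding flip_word_def by (induction w) auto

lemma psum_flip_word:
  "set w \<subseteq> {0, 1} \<Longrightarrow> i \<le> length w \<Longrightarrow> psum (flip_word w) i + psum w i = i"
proof (induction w arbitrary: i)
  case (Cons x w)
  then show ?case by (cases i) (auto simp: flip_word_def)
qed (simp add: flip_word_def)

lemma length_flip_word: "length (flip_word w) = length w"
  by (simp add: flip_word_def)

lemma sum_list_flip_word: "set w \<subseteq> {0, 1} \<Longrightarrow> sum_list (flip_word w) + sum_list w = length w"
  using psum_flip_word[of w "length w"] by (simp add: length_flip_word)

lemma set_flip_word: "set w \<subseteq> {0, 1} \<Longrightarrow> set (flip_word w) \<subseteq> {0, 1}"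
  by (auto simp: flip_word_def)

lemma evenly_flip_word:
  assumes "set w \<subseteq> {0, 1}" "evenly w"
  shows "evenly (flip_word w)"
  unfolding evenly_def
proof (intro allI impI)
  fix i j k assume "i + k \<le> length (flip_word w)" "j + k \<le> length (flip_word w)"
  then have l: "i + k \<le> length w" "j + k \<le> length w" by (simp_all add: length_flip_word)
  show "psum (flip_word w) (i + k) + psum (flip_word w) j
      \<le> psum (flip_word w) (j + k) + psum (flip_word w) i + 1"
    using evenlyD[OF assms(2) l(2,1)] psum_flip_word[OF assms(1), of "i + k"]
      psum_flip_word[OF assms(1), of "j + k"] psum_flip_word[OF assms(1), of i]
      psum_flip_word[OF assms(1), of j] l
    by linarith
qed

lemma even_wordsD:
  assumes "w \<in> even_words n"
  shows "set w \<subseteq> {0, 1}" "length w = n" "evenly w"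
  using assms by (auto simp: even_words_def binaries_def)

lemma flip_word_even_words:
  assumes "w \<in> even_words n"
  shows "flip_word w \<in> even_words n"
  using set_flip_word[OF even_wordsD(1)[OF assms]] evenly_flip_word[OF even_wordsD(1,3)[OF assms]]
    even_wordsD(2)[OF assms]
  by (simp add: even_words_def binaries_def length_flip_word)

lemma bij_betw_flip_word: "bij_betw flip_word (even_words n) (even_words n)"
  by (rule bij_betw_byWitness[where f' = flip_word])
    (auto simp: flip_word_even_words flip_word_flip_word[OF even_wordsD(1)])

lemma card_balanced_words_flip:
  assumes "k \<le> n"
  shows "card (balanced_words n (n - k)) = card (balanced_words n k)"
proof (rule bij_betw_same_card)
  show "bij_betw flip_word (balanced_words n (n - k)) (balanced_words n k)"
  proof (rule bij_betw_byWitness[where f' = flip_word])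
    show "\<forall>w\<in>balanced_words n (n - k). flip_word (flip_word w) = w"
      "\<forall>w\<in>balanced_words n k. flip_word (flip_word w) = w"
      by (auto simp: balanced_words_eq flip_word_flip_word[OF even_wordsD(1)])
    have "sum_list (flip_word w) = n - sum_list w" if "w \<in> even_words n" for w
      using sum_list_flip_word[of w] even_wordsD[OF that] by simp
    then show "flip_word ` balanced_words n (n - k) \<subseteq> balanced_words n k"
      "flip_word ` balanced_words n k \<subseteq> balanced_words n (n - k)"
      using assms by (auto simp: balanced_words_eq flip_word_even_words)
  qed
qed

lemma evenly_append_left: "evenly (u @ v) \<Longrightarrow> evenly u"
  unfolding evenly_def
proof (intro allI impI)
  fix i j k
  assume ev: "\<forall>i j k. i + k \<le> length (u @ v) \<longrightarrow> j + k \<le> length (u @ v) \<longrightarrow>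
     psum (u @ v) (i + k) + psum (u @ v) j \<le> psum (u @ v) (j + k) + psum (u @ v) i + 1"
    and "i + k \<le> length u" "j + k \<le> length u"
  then show "psum u (i + k) + psum u j \<le> psum u (j + k) + psum u i + 1"
    using ev[rule_format, of i k j] by simp
qed

lemma evenly_Cons_right: "evenly (x # u) \<Longrightarrow> evenly u"
  unfolding evenly_def
proof (intro allI impI)
  fix i j k
  assume ev: "\<forall>i j k. i + k \<le> length (x # u) \<longrightarrow> j + k \<le> length (x # u) \<longrightarrow>
     psum (x # u) (i + k) + psum (x # u) j \<le> psum (x # u) (j + k) + psum (x # u) i + 1"
    and "i + k \<le> length u" "j + k \<le> length u"
  then show "psum u (i + k) + psum u j \<le> psum u (j + k) + psum u i + 1"
    using ev[rule_format, of "Suc i" k "Suc j"] by simp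
qed

text \<open>The only comparison not inside one of the two shorter words is between a prefix and a
  suffix of equal length; deleting the outer 1 from each reduces it to balance of
  \<open>g\<close>.\<close>

lemma evenly_one_snoc_one_iff:
  "evenly (1 # g @ [1]) \<longleftrightarrow> evenly (1 # g) \<and> evenly (g @ [1])"
proof
  assume "evenly (1 # g @ [1])"
  then show "evenly (1 # g) \<and> evenly (g @ [1])"
    using evenly_append_left[of "1 # g"] evenly_Cons_right[of 1 "g @ [1]"] by simp
next
  assume ev: "evenly (1 # g) \<and> evenly (g @ [1])"
  let ?w = "1 # g @ [1]"
  have evg: "evenly g" using ev evenly_Cons_right by blast
  have mid: "psum ?w (i + k) + psum ?w j \<le> psum ?w (j + k) + psum ?w i + 1"
    if "i + k \<le> length ?w" "j + k \<le> length ?w" for i j k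
  proof -
    have l: "i + k \<le> Suc (Suc (length g))" "j + k \<le> Suc (Suc (length g))" using that by auto
    show ?thesis
    proof (cases k)
      case (Suc k')
      have "i = j \<or> (i + k \<le> Suc (length g) \<and> j + k \<le> Suc (length g)) \<or> (i \<ge> 1 \<and> j \<ge> 1) \<or>
          (i = 0 \<and> j \<ge> 1 \<and> j + k = Suc (Suc (length g))) \<or>
          (j = 0 \<and> i \<ge> 1 \<and> i + k = Suc (Suc (length g)))"
        using l by arith
      then consider "i = j" | "i + k \<le> Suc (length g)" "j + k \<le> Suc (length g)"
        | "i \<ge> 1" "j \<ge> 1" | "i = 0" "j \<ge> 1" "j + k = Suc (Suc (length g))"
        | "j = 0" "i \<ge> 1" "i + k = Suc (Suc (length g))"
        by blast
      then show ?thesis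
      proof cases
        case 2
        then have "psum (1 # g) (i + k) + psum (1 # g) j \<le> psum (1 # g) (j + k) + psum (1 # g) i + 1"
          using ev by (intro evenlyD) auto
        moreover have "psum ?w x = psum (1 # g) x" if "x \<le> Suc (length g)" for x
          using that by (cases x) auto
        ultimately show ?thesis using 2 by simp
      next
        case 3
        then obtain i' j' where "i = Suc i'" "j = Suc j'"
          by (metis One_nat_def Suc_le_D)
        then show ?thesis using evenlyD[of "g @ [1]" i' k j'] ev l by simp
      next
        case 4
        then obtain j' where "j = Suc j'" by (metis One_nat_def Suc_le_D)
        then show ?thesis using evenlyD[OF evg, of 0 k' j'] 4 Suc by simp
      next
        case 5
        then obtain i' where "i = Suc i'" by (metis One_nat_def Suc_le_D)
        then show ?thesis using evenlyD[OF evg, of i' k' 0] 5 Suc by simp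
      qed simp
    qed simp
  qed
  then show "evenly ?w" unfolding evenly_def by blast
qed

section \<open>Words as gap data\<close>

lemma zero_mem_of_sum_list_less: "sum_list g < length g \<Longrightarrow> 0 \<in> set (g :: nat list)"
proof (induction g)
  case (Cons x g)
  then show ?case by (cases x) auto
qed simp

lemma map_add_unique:
  fixes g g' :: "nat list"
  assumes "map ((+) m) g = map ((+) m') g'" "sum_list g < length g" "sum_list g' < length g'"
  shows "m = m'" "g = g'"
proof -
  have "m \<in> (+) m' ` set g'" "m' \<in> (+) m ` set g"
    using zero_mem_of_sum_list_less[OF assms(2)] zero_mem_of_sum_list_less[OF assms(3)] assms(1)
    by (metis add_0_right image_eqI set_map)+
  then show m: "m = m'" by auto
  show "g = g'" using assms(1) m by (simp add: inj_map_eq_map)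
qed

text \<open>The all-ones word is excluded because its shift by \<open>m\<close> is the shift of the
  all-zeros word by \<open>m + 1\<close>.\<close>

definition gap_words :: "nat \<Rightarrow> nat list set" where
  "gap_words n = {g \<in> even_words n. sum_list g < n}"

text \<open>In a tuple \<open>(g, m, a, b)\<close> the gaps between consecutive ones are given by \<open>m - 1 + g\<^sub>i\<close>,
  and \<open>a\<close>, \<open>b\<close> are the lengths of the initial and final runs of zeros. For \<open>m = 0\<close> the
  subtraction truncates; those tuples exist only for short words, where they are counted by
  \<open>card_gap_data_short\<close>.\<close>

definition gap_data :: "nat \<Rightarrow> nat \<Rightarrow> (nat list \<times> nat \<times> nat \<times> nat) set" where
  "gap_data n L = (SIGMA g:gap_words n.
     {(m, a, b). a < m + lext g \<and> b < m + rext g \<and> m * n + sum_list g + 1 + a + b = L})"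

lemma dec_inject: "dec cs = dec cs' \<Longrightarrow> cs \<noteq> [] \<Longrightarrow> cs' \<noteq> [] \<Longrightarrow> cs = cs'"
  by (metis enc_dec)

lemma card_gap_data_long:
  assumes "Suc n \<le> L" "1 \<le> n"
  shows "card (gap_data n L) = card (balanced_words L (Suc n))"
proof (rule bij_betw_same_card)
  let ?f = "\<lambda>(g, m, a, b). dec (a # map ((+) (m - 1)) g @ [b])"
  have gw: "length g = n" "g \<in> binaries n" "evenly g" "sum_list g < n" if "g \<in> gap_words n" for g
    using that by (auto simp: gap_words_def even_words_def binaries_def)
  \<comment> \<open>For \<open>m = 0\<close> the strict bounds force \<open>a = b = 0\<close>, so
    \<open>L\<close> would be \<open>sum_list g + 1\<close>, at most \<open>n\<close>. Hence
    \<open>m - 1\<close> does not truncate.\<close>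
  have m1: "1 \<le> m" if "(g, m, a, b) \<in> gap_data n L" for g m a b
  proof (rule ccontr)
    assume "\<not> 1 \<le> m"
    then have "m = 0" by simp
    moreover have "a < m + lext g" "b < m + rext g" "m * n + sum_list g + 1 + a + b = L"
        "g \<in> gap_words n"
      using that by (auto simp: gap_data_def)
    moreover have "lext g \<le> 1" "rext g \<le> 1" by simp_all
    ultimately have "a < 1" "b < 1" by linarith+
    moreover have "sum_list g + 1 + a + b = L" "g \<in> gap_words n"
      using that \<open>m = 0\<close> by (auto simp: gap_data_def)
    ultimately show False using gw(4)[of g] assms by simp
  qed
  show "bij_betw ?f (gap_data n L) (balanced_words L (Suc n))"
    unfolding bij_betw_def
  proof
    show "inj_on ?f (gap_data n L)"
    proof (rule inj_onI, clarify)
      fix g m a b g' m' a' b'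
      assume x: "(g, m, a, b) \<in> gap_data n L" and y: "(g', m', a', b') \<in> gap_data n L"
        and eq: "dec (a # map ((+) (m - 1)) g @ [b]) = dec (a' # map ((+) (m' - 1)) g' @ [b'])"
      have "a # map ((+) (m - 1)) g @ [b] = a' # map ((+) (m' - 1)) g' @ [b']"
        by (rule dec_inject[OF eq]) simp_all
      then have eq: "a = a'" "b = b'" "map ((+) (m - 1)) g = map ((+) (m' - 1)) g'" by auto
      have "g \<in> gap_words n" "g' \<in> gap_words n" using x y by (auto simp: gap_data_def)
      then have "m - 1 = m' - 1" "g = g'"
        using map_add_unique[OF eq(3)] gw by auto
      then show "g = g' \<and> (m, a, b) = (m', a', b')" using eq m1[OF x] m1[OF y] by simp
    qed
    show "?f ` gap_data n L = balanced_words L (Suc n)"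
    proof (intro equalityI subsetI)
      fix w assume "w \<in> ?f ` gap_data n L"
      then obtain g m a b where x: "(g, m, a, b) \<in> gap_data n L"
        and w: "w = dec (a # map ((+) (m - 1)) g @ [b])" by auto
      have g: "g \<in> gap_words n" and ab: "a < m + lext g" "b < m + rext g"
        and L: "m * n + sum_list g + 1 + a + b = L"
        using x by (auto simp: gap_data_def)
      obtain m' where m: "m = Suc m'" using m1[OF x] by (cases m) auto
      have "evenly w"
        unfolding w using evenly_dec_shifted_iff[OF gw(2,4)[OF g], of a m' b] gw(3)[OF g] ab m
        by (simp del: dec.simps)
      moreover have "length w = L"
        unfolding w length_dec using L gw(1)[OF g] m by (simp add: sum_list_map_add algebra_simps)
      moreover have "sum_list w = Suc n"
        unfolding w sum_list_dec using gw(1)[OF g] by simp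
      moreover have "set w \<subseteq> {0, 1}" unfolding w by (rule set_dec)
      ultimately show "w \<in> balanced_words L (Suc n)"
        by (simp add: balanced_words_eq even_words_def binaries_def)
    next
      fix w assume "w \<in> balanced_words L (Suc n)"
      then have w: "set w \<subseteq> {0, 1}" "length w = L" "evenly w" "sum_list w = Suc n"
        by (auto simp: balanced_words_eq even_words_def binaries_def)
      have len: "length (enc w) = Suc (Suc n)" using length_enc[OF w(1)] w(4) by simp
      then obtain a c b where e: "enc w = a # c @ [b]" "length c = n"
        by (metis length_Suc_conv length_append_singleton rev_exhaust length_0_conv nat.inject Zero_not_Suc)
      have de: "dec (a # c @ [b]) = w" using dec_enc[OF w(1)] e(1) by (simp del: dec.simps)
      then have "evenly c"
        using w(3) evenly_dec_iff[of "a # c @ [b]"] gap_even_iff by (simp del: dec.simps)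
      then obtain m g where c: "c = map ((+) m) g" "g \<in> even_words n" "sum_list g < n"
        using evenly_imp_shifted_binary[of c] e(2) assms(2) by (metis list.size(3) not_one_le_zero)
      have g: "g \<in> binaries n" "length g = n"
        using c(2) by (auto simp: even_words_def binaries_def)
      have "a \<le> m + lext g" "b \<le> m + rext g"
        using evenly_dec_shifted_iff[OF g(1) c(3)] w(3) de c(1) by blast+
      \<comment> \<open>Each of the \<open>n\<close> inner gaps absorbs one of the
        \<open>n + 1\<close> ones, which raises the shift by 1 and leaves the summand 1.\<close>
      moreover have "Suc m * n + sum_list g + 1 + a + b = L"
        using length_dec[of "a # c @ [b]"] de w(2) g(2)
        by (simp add: c(1) sum_list_map_add del: dec.simps)
      ultimately have "(g, Suc m, a, b) \<in> gap_data n L"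
        using c by (auto simp: gap_data_def gap_words_def)
      moreover have "w = ?f (g, Suc m, a, b)" using de c(1) by (simp del: dec.simps)
      ultimately show "w \<in> ?f ` gap_data n L" by blast
    qed
  qed
qed

lemma dec_zero_snoc_zero:
  assumes "c \<noteq> []"
  shows "dec (0 # c @ [0]) = 1 # dec c @ [1]"
proof -
  have "enc (1 # dec c @ [1]) = 0 # c @ [0]" using enc_snoc[of "dec c"] enc_dec[OF assms] by simp
  moreover have "set (1 # dec c @ [1]) \<subseteq> {0, 1}" using set_dec[of c] by simp
  ultimately show ?thesis using dec_enc[of "1 # dec c @ [1]"] by (simp del: dec.simps enc.simps)
qed

text \<open>Only \<open>m = a = b = 0\<close> contributes here, so this counts the words \<open>1 g 1\<close>; the gap sequence
  of such a word is a shifted balanced word of length \<open>L\<close>, which exchanges the roles of length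
  and height.\<close>

lemma card_gap_data_short:
  assumes "1 \<le> L" "L \<le> n"
  shows "card (gap_data n L) = card (balanced_words L (Suc n mod L))"
proof -
  define D where "D = {g \<in> gap_words n. evenly (1 # g @ [1]) \<and> Suc (sum_list g) = L}"
  \<comment> \<open>A word in \<open>D\<close> has \<open>L - 1\<close> ones, hence \<open>L\<close>
    gaps. If these are a shift by \<open>m\<close> of a word of height \<open>s < L\<close>, then
    \<open>n = m * L + s + (L - 1)\<close>, so division of \<open>n + 1\<close> by \<open>L\<close>
    yields both \<open>m\<close> and \<open>s\<close>.\<close>
  define m where "m = Suc n div L - 1"
  have dm: "Suc n = Suc m * L + Suc n mod L"
  proof -
    have "Suc n div L \<ge> 1" using assms by (simp add: div_greater_zero_iff Suc_leI)
    then show ?thesis unfolding m_def by simp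
  qed
  have m0: "m = 0" if "m * n + s + 1 + a + b = L" "a < m + A" "b < m + B" for m s a b A B :: nat
    using that assms by (cases m) auto
  have "gap_data n L = (\<lambda>g. (g, 0 :: nat, 0 :: nat, 0 :: nat)) ` D"
  proof (intro equalityI subsetI)
    fix x assume "x \<in> gap_data n L"
    then obtain g m a b where x: "x = (g, m, a, b)" "g \<in> gap_words n"
      "a < m + lext g" "b < m + rext g" "m * n + sum_list g + 1 + a + b = L"
      by (auto simp: gap_data_def)
    have "m = 0" by (rule m0[OF x(5,3,4)])
    moreover have "evenly (1 # g)" "evenly (g @ [1])" "a = 0" "b = 0"
      using x(3,4) unfolding \<open>m = 0\<close> by (cases "evenly (1 # g)"; cases "evenly (g @ [1])"; simp)+
    ultimately show "x \<in> (\<lambda>g. (g, 0 :: nat, 0 :: nat, 0 :: nat)) ` D"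
      using x evenly_one_snoc_one_iff[of g] by (auto simp: D_def)
  next
    fix x assume "x \<in> (\<lambda>g. (g, 0 :: nat, 0 :: nat, 0 :: nat)) ` D"
    then show "x \<in> gap_data n L"
      using evenly_one_snoc_one_iff by (auto simp: D_def gap_data_def)
  qed
  then have "card (gap_data n L) = card D"
    by (simp add: card_image inj_on_def)
  also have "\<dots> = card (balanced_words L (Suc n mod L))"
  proof (rule bij_betw_same_card[symmetric])
    let ?f = "\<lambda>g. dec (map ((+) m) g)"
    show "bij_betw ?f (balanced_words L (Suc n mod L)) D"
      unfolding bij_betw_def
    proof
      have w: "length g = L" "g \<in> binaries L" "evenly g" "sum_list g = Suc n mod L" "sum_list g < L"
        if "g \<in> balanced_words L (Suc n mod L)" for g
        using that assms by (auto simp: balanced_words_eq even_words_def binaries_def)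
      show "inj_on ?f (balanced_words L (Suc n mod L))"
      proof (rule inj_onI)
        fix g g' assume g: "g \<in> balanced_words L (Suc n mod L)" "g' \<in> balanced_words L (Suc n mod L)"
          and eq: "dec (map ((+) m) g) = dec (map ((+) m) g')"
        have "g \<noteq> []" "g' \<noteq> []" using w(1)[OF g(1)] w(1)[OF g(2)] assms by force+
        then have "map ((+) m) g = map ((+) m) g'"
          by (intro dec_inject[OF eq]) simp_all
        then show "g = g'" by (simp add: inj_map_eq_map)
      qed
      show "?f ` balanced_words L (Suc n mod L) = D"
      proof (intro equalityI subsetI)
        fix x assume "x \<in> ?f ` balanced_words L (Suc n mod L)"
        then obtain g where g: "g \<in> balanced_words L (Suc n mod L)" and x: "x = ?f g" by auto
        have ne: "map ((+) m) g \<noteq> []" using w(1)[OF g] assms by auto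
        have ev: "evenly (1 # x @ [1])"
          unfolding x dec_zero_snoc_zero[OF ne, symmetric]
          using evenly_dec_shifted_iff[OF w(2)[OF g] w(5)[OF g], of 0 m 0] w(3)[OF g]
          by (simp del: dec.simps)
        then have "evenly x" using evenly_append_left[of x "[1]"] evenly_Cons_right by blast
        moreover have "Suc (sum_list x) = L"
          unfolding x sum_list_dec using w(1)[OF g] assms by simp
        moreover have "length x = n"
        proof -
          have "length x = m * L + sum_list g + (L - 1)"
            unfolding x length_dec using w(1)[OF g] by (simp add: sum_list_map_add)
          moreover have "Suc n = L + m * L + sum_list g" using dm w(4)[OF g] by (metis mult_Suc)
          ultimately show ?thesis using assms by linarith
        qed
        moreover have "set x \<subseteq> {0, 1}" unfolding x by (rule set_dec)
        ultimately show "x \<in> D"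
          using ev assms by (auto simp: D_def gap_words_def even_words_def binaries_def)
      next
        fix x assume "x \<in> D"
        then have x: "set x \<subseteq> {0, 1}" "length x = n" "evenly x" "evenly (1 # x @ [1])"
          "Suc (sum_list x) = L"
          by (auto simp: D_def gap_words_def even_words_def binaries_def)
        have dx: "dec (enc x) = x" by (rule dec_enc[OF x(1)])
        have lx: "length (enc x) = L" using length_enc[OF x(1)] x(5) by simp
        have "evenly (dec (0 # enc x @ [0]))"
          using dec_zero_snoc_zero[OF enc_not_Nil, of x] dx x(4) by simp
        then have "evenly (enc x)"
          using evenly_dec_iff[of "0 # enc x @ [0]"] gap_even_iff by (simp del: dec.simps)
        then obtain m' g where g: "enc x = map ((+) m') g" "g \<in> even_words L" "sum_list g < L"
          using evenly_imp_shifted_binary[of "enc x"] lx by (metis enc_not_Nil)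
        have lg: "length g = L" using g(2) by (simp add: even_words_def binaries_def)
        have "n = m' * L + sum_list g + (L - 1)"
          using length_dec[of "enc x"] dx x(2) lx lg by (simp add: g(1) sum_list_map_add)
        then have sn: "Suc n = sum_list g + Suc m' * L" using assms by simp
        have "Suc n mod L = sum_list g" "Suc n div L = Suc m'"
          unfolding sn using g(3) assms by (simp_all del: mult_Suc)
        then have "m' = m" "g \<in> balanced_words L (Suc n mod L)"
          using g(2) by (simp_all add: m_def balanced_words_eq)
        then show "x \<in> ?f ` balanced_words L (Suc n mod L)"
          using dx g(1) by (intro image_eqI[of _ _ g]) auto
      qed
    qed
  qed
  finally show ?thesis .
qed

lemma gap_data_zero: "gap_data n 0 = {}"
  by (auto simp: gap_data_def)

lemma num_balanced_eq_card_gap_data: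
  assumes "1 \<le> n"
  shows "num_balanced (int L) (int (Suc n)) = card (gap_data n L)"
proof -
  consider "L = 0" | "1 \<le> L" "L \<le> n" | "L = Suc n" | "Suc n < L" by linarith
  then show ?thesis
  proof cases
    case 1
    then show ?thesis by (simp add: num_balanced_def gap_data_zero)
  next
    case 2
    then show ?thesis
      using card_gap_data_short[OF 2]
      by (simp add: num_balanced_def nat_mod_distrib flip: of_nat_Suc)
  next
    case 3
    \<comment> \<open>Here \<open>h mod L = 0\<close>, whereas the gap data count words of height
      \<open>L\<close>; complementation matches the two.\<close>
    then show ?thesis
      using card_gap_data_long[of n L] assms card_balanced_words_flip[of 0 L]
      by (simp add: num_balanced_def flip: of_nat_Suc)
  next
    case 4
    then show ?thesis
      using card_gap_data_long[of n L] assms by (simp add: num_balanced_def flip: of_nat_Suc)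
  qed
qed

section \<open>Sums of triangular functions along progressions\<close>

definition tri :: "int \<Rightarrow> int" where
  "tri t = max 0 (t + 1)"

text \<open>Inclusion-exclusion on the two upper bounds; \<open>tri t\<close> counts the pairs of naturals with
  sum \<open>t\<close>.\<close>

lemma card_bounded_pairs:
  "int (card {(a, b). a < p \<and> b < q \<and> c + a + b = L}) =
     (let t = int L - int c in tri t - tri (t - int p) - tri (t - int q) + tri (t - int p - int q))"
proof -
  \<comment> \<open>Since \<open>b = L - c - a\<close>, the bound \<open>b < q\<close> is a lower
    bound on \<open>a\<close> (truncated at 0) and \<open>b \<ge> 0\<close> an upper one.\<close>
  define lo where "lo = Suc L - (c + q)"
  define hi where "hi = min p (Suc L - c)"
  have "{(a, b). a < p \<and> b < q \<and> c + a + b = L} = (\<lambda>a. (a, L - c - a)) ` {lo..<hi}"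
    by (auto simp: lo_def hi_def image_iff)
  then have "card {(a, b). a < p \<and> b < q \<and> c + a + b = L} = hi - lo"
    by (simp add: card_image inj_on_def)
  moreover have "int (hi - lo) =
      (let t = int L - int c in tri t - tri (t - int p) - tri (t - int q) + tri (t - int p - int q))"
    unfolding Let_def tri_def lo_def hi_def by linarith
  ultimately show ?thesis by simp
qed

text \<open>An arithmetic series with \<open>T div j + 1\<close> nonzero terms, all within the range
  as \<open>T \<le> L\<close>. The bound \<open>- int j \<le> T\<close> admits the quotient -1,
  where the sum is empty and the first factor on the right vanishes.\<close>

lemma sum_tri_progression:
  assumes "1 \<le> j" "- int j \<le> T" "T \<le> int L"
  shows "2 * int j * (\<Sum>m\<le>L. tri (T - int m * int j)) =
    (T - T mod int j + int j) * (T + T mod int j + 2)"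
proof -
  define q where "q = T div int j"
  define r where "r = T mod int j"
  have T: "T = q * int j + r" by (simp add: q_def r_def)
  have r: "0 \<le> r" "r < int j" using assms(1) by (simp_all add: r_def)
  have q1: "- 1 \<le> q"
  proof (rule ccontr)
    assume "\<not> - 1 \<le> q"
    then have "q * int j \<le> (- 2) * int j" by (intro mult_right_mono) auto
    then show False using T r assms by linarith
  qed
  define Q where "Q = nat (q + 1)"
  have Q: "int Q = q + 1" using q1 by (simp add: Q_def)
  have "q \<le> int L"
  proof (cases "0 \<le> q")
    case True
    then have "q * 1 \<le> q * int j" using assms(1) by (intro mult_left_mono) auto
    then show ?thesis using T r assms(3) by linarith
  qed simp
  then have QL: "Q \<le> Suc L" using Q by linarith
  have "(\<Sum>m\<le>L. tri (T - int m * int j)) = (\<Sum>m<Q. T + 1 - int m * int j)"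
  proof (rule sum.mono_neutral_cong_right)
    show "{..<Q} \<subseteq> {..L}" using QL by auto
    show "\<forall>m\<in>{..L} - {..<Q}. tri (T - int m * int j) = 0"
    proof
      fix m assume "m \<in> {..L} - {..<Q}"
      then have "q + 1 \<le> int m" using Q by auto
      then have "(q + 1) * int j \<le> int m * int j" by (intro mult_right_mono) auto
      then show "tri (T - int m * int j) = 0" using T r by (simp add: tri_def algebra_simps)
    qed
    fix m assume "m \<in> {..<Q}"
    then have "int m \<le> q" using Q by auto
    then have "int m * int j \<le> q * int j" by (intro mult_right_mono) auto
    then show "tri (T - int m * int j) = T + 1 - int m * int j"
      using T r unfolding tri_def by linarith
  qed simp
  moreover have "2 * (\<Sum>m<Q. T + 1 - int m * int j) = int Q * (2 * (T + 1) - int j * (int Q - 1))"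
    by (induction Q) (simp_all add: algebra_simps)
  ultimately have twice: "2 * (\<Sum>m\<le>L. tri (T - int m * int j)) =
      int Q * (2 * (T + 1) - int j * (int Q - 1))"
    by simp
  have "2 * int j * (\<Sum>m\<le>L. tri (T - int m * int j)) =
      int j * (2 * (\<Sum>m\<le>L. tri (T - int m * int j)))"
    by simp
  also have "\<dots> = (int j * int Q) * (2 * (T + 1) - (int j * int Q - int j))"
    unfolding twice by (simp add: algebra_simps)
  also have "int j * int Q = T - r + int j" using T Q by (simp add: algebra_simps)
  finally show ?thesis by (simp add: r_def algebra_simps)
qed

text \<open>In the product of \<open>sum_tri_progression\<close> the mixed terms in \<open>T\<close>
  and its residue cancel, so only the constant term depends on \<open>L mod j\<close>. The bound
  \<open>e \<le> j\<close> makes the formula valid from \<open>L = 0\<close> on.\<close>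

lemma sum_tri_quasipolynomial:
  assumes "1 \<le> j" "e \<le> j"
  shows "\<exists>p :: nat \<Rightarrow> rat. \<forall>L.
    of_int (\<Sum>m\<le>L. tri (int L - int e - int m * int j)) =
      (of_nat L)\<^sup>2 / (2 * of_nat j) + (1 / 2 + (1 - of_nat e) / of_nat j) * of_nat L + p (L mod j)"
proof (intro exI allI)
  fix L :: nat
  define \<rho> where "\<rho> r = (int r - int e) mod int j" for r
  define T where "T = int L - int e"
  have \<rho>: "T mod int j = \<rho> (L mod j)" by (simp add: T_def \<rho>_def zmod_int mod_diff_left_eq)
  have "2 * int j * (\<Sum>m\<le>L. tri (T - int m * int j)) =
      (T - \<rho> (L mod j) + int j) * (T + \<rho> (L mod j) + 2)"
    using sum_tri_progression[of j T L] assms \<rho> by (simp add: T_def)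
  then have "of_int (2 * int j * (\<Sum>m\<le>L. tri (T - int m * int j))) =
      (of_int ((T - \<rho> (L mod j) + int j) * (T + \<rho> (L mod j) + 2)) :: rat)"
    by (rule arg_cong)
  then have "2 * of_nat j * of_int (\<Sum>m\<le>L. tri (T - int m * int j)) =
      ((of_nat L - of_nat e - of_int (\<rho> (L mod j)) + of_nat j) *
       (of_nat L - of_nat e + of_int (\<rho> (L mod j)) + 2) :: rat)"
    by (simp add: T_def)
  then have "of_int (\<Sum>m\<le>L. tri (T - int m * int j)) =
      ((of_nat L - of_nat e - of_int (\<rho> (L mod j)) + of_nat j) *
       (of_nat L - of_nat e + of_int (\<rho> (L mod j)) + 2) / (2 * of_nat j) :: rat)"
    using assms(1) by (simp add: eq_divide_eq mult.commute)
  also have "\<dots> = (of_nat L)\<^sup>2 / (2 * of_nat j) + (1 / 2 + (1 - of_nat e) / of_nat j) * of_nat L +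
      (\<lambda>r. ((of_nat e)\<^sup>2 - (of_nat j + 2) * of_nat e +
        (of_nat j - of_int (\<rho> r)) * (of_int (\<rho> r) + 2)) / (2 * of_nat j)) (L mod j)"
    using assms(1) by (simp add: field_simps power2_eq_square)
  finally show "of_int (\<Sum>m\<le>L. tri (int L - int e - int m * int j)) =
      (of_nat L)\<^sup>2 / (2 * of_nat j) + (1 / 2 + (1 - of_nat e) / of_nat j) * of_nat L +
      (\<lambda>r. ((of_nat e)\<^sup>2 - (of_nat j + 2) * of_nat e +
        (of_nat j - of_int ((int r - int e) mod int j)) *
        (of_int ((int r - int e) mod int j) + 2)) / (2 * of_nat j :: rat)) (L mod j)"
    by (simp add: T_def \<rho>_def)
qed

section \<open>Counting the triples for a fixed word\<close>

lemma finite_triples: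
  assumes "1 \<le> n"
  shows "finite {(m, a, b). a < m + A \<and> b < m + B \<and> m * n + s + 1 + a + b = (L :: nat)}"
proof (rule finite_subset)
  have "m \<le> L" if "m * n + s + 1 + a + b = L" for m a b
  proof -
    have "m * 1 \<le> m * n" using assms by (intro mult_le_mono) auto
    then show ?thesis using that by linarith
  qed
  then show "{(m, a, b). a < m + A \<and> b < m + B \<and> m * n + s + 1 + a + b = L} \<subseteq>
      {..L} \<times> {..L} \<times> {..L}"
    by auto
qed simp

text \<open>Inclusion-exclusion with bounds \<open>m + A\<close> and \<open>m + B\<close>: each
  violated bound subtracts a further \<open>m\<close> from the argument, which raises the step from
  \<open>n\<close> to \<open>n + 1\<close> or \<open>n + 2\<close>.\<close>

lemma card_triples:
  assumes "1 \<le> n"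
  shows "int (card {(m, a, b). a < m + A \<and> b < m + B \<and> m * n + s + 1 + a + b = L}) =
    (\<Sum>m\<le>L. tri (int L - int (s + 1) - int m * int n)) -
    (\<Sum>m\<le>L. tri (int L - int (s + 1 + A) - int m * int (n + 1))) -
    (\<Sum>m\<le>L. tri (int L - int (s + 1 + B) - int m * int (n + 1))) +
    (\<Sum>m\<le>L. tri (int L - int (s + 1 + A + B) - int m * int (n + 2)))"
proof -
  define P where "P m = {(a, b). a < m + A \<and> b < m + B \<and> (m * n + s + 1) + a + b = L}" for m
  have "{(m, a, b). a < m + A \<and> b < m + B \<and> m * n + s + 1 + a + b = L} = (SIGMA m:{..L}. P m)"
  proof -
    have "m \<le> L" if "m * n + s + 1 + a + b = L" for m a b
    proof -
      have "m * 1 \<le> m * n" using assms by (intro mult_le_mono) auto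
      then show ?thesis using that by linarith
    qed
    then show ?thesis by (auto simp: P_def)
  qed
  moreover have "finite (P m)" for m
    by (rule finite_subset[of _ "{..L} \<times> {..L}"]) (auto simp: P_def)
  ultimately have "int (card {(m, a, b). a < m + A \<and> b < m + B \<and> m * n + s + 1 + a + b = L}) =
      (\<Sum>m\<le>L. int (card (P m)))"
    by simp
  also have "\<dots> = (\<Sum>m\<le>L. tri (int L - int (s + 1) - int m * int n) -
      tri (int L - int (s + 1 + A) - int m * int (n + 1)) -
      tri (int L - int (s + 1 + B) - int m * int (n + 1)) +
      tri (int L - int (s + 1 + A + B) - int m * int (n + 2)))"
  proof (rule sum.cong[OF refl])
    fix m
    have eqs: "int L - int (m * n + s + 1) = int L - int (s + 1) - int m * int n"
      "int L - int (m * n + s + 1) - int (m + A) = int L - int (s + 1 + A) - int m * int (n + 1)"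
      "int L - int (m * n + s + 1) - int (m + B) = int L - int (s + 1 + B) - int m * int (n + 1)"
      "int L - int (m * n + s + 1) - int (m + A) - int (m + B) =
        int L - int (s + 1 + A + B) - int m * int (n + 2)"
      by (simp_all add: algebra_simps)
    show "int (card (P m)) = tri (int L - int (s + 1) - int m * int n) -
      tri (int L - int (s + 1 + A) - int m * int (n + 1)) -
      tri (int L - int (s + 1 + B) - int m * int (n + 1)) +
      tri (int L - int (s + 1 + A + B) - int m * int (n + 2))"
      unfolding P_def card_bounded_pairs Let_def unfolding eqs(4) unfolding eqs(2,3) unfolding eqs(1) ..
  qed
  finally show ?thesis by (simp add: sum.distrib sum_subtractf)
qed

text \<open>The assumptions keep each of the four offsets at most equal to its step, so all
  progressions are quasi-polynomial for every \<open>L\<close>. Their linear summands 1/2 cancel,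
  and the two parts of period \<open>n + 1\<close> merge.\<close>

lemma card_triples_quasipolynomial:
  assumes "s < n" "A \<le> 1" "B \<le> 1"
  shows "\<exists>p q r :: nat \<Rightarrow> rat. \<forall>L.
    of_nat (card {(m, a, b). a < m + A \<and> b < m + B \<and> m * n + s + 1 + a + b = L}) =
      (1 / (2 * of_nat n) - 1 / of_nat (n + 1) + 1 / (2 * of_nat (n + 2))) * (of_nat L)\<^sup>2 +
      (- of_nat s / of_nat n + of_nat (2 * s + A + B) / of_nat (n + 1)
        - of_nat (s + A + B) / of_nat (n + 2)) * of_nat L +
      p (L mod n) + q (L mod (n + 1)) + r (L mod (n + 2))"
proof -
  obtain p where p: "\<And>L. of_int (\<Sum>m\<le>L. tri (int L - int (s + 1) - int m * int n)) =
      (of_nat L)\<^sup>2 / (2 * of_nat n) + (1 / 2 + (1 - of_nat (s + 1)) / of_nat n) * of_nat L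
      + (p (L mod n) :: rat)"
    using sum_tri_quasipolynomial[of n "s + 1"] assms by auto
  obtain q1 where q1: "\<And>L. of_int (\<Sum>m\<le>L. tri (int L - int (s + 1 + A) - int m * int (n + 1))) =
      (of_nat L)\<^sup>2 / (2 * of_nat (n + 1)) + (1 / 2 + (1 - of_nat (s + 1 + A)) / of_nat (n + 1)) * of_nat L
      + (q1 (L mod (n + 1)) :: rat)"
    using sum_tri_quasipolynomial[of "n + 1" "s + 1 + A"] assms by auto
  obtain q2 where q2: "\<And>L. of_int (\<Sum>m\<le>L. tri (int L - int (s + 1 + B) - int m * int (n + 1))) =
      (of_nat L)\<^sup>2 / (2 * of_nat (n + 1)) + (1 / 2 + (1 - of_nat (s + 1 + B)) / of_nat (n + 1)) * of_nat L
      + (q2 (L mod (n + 1)) :: rat)"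
    using sum_tri_quasipolynomial[of "n + 1" "s + 1 + B"] assms by auto
  obtain r where r: "\<And>L. of_int (\<Sum>m\<le>L. tri (int L - int (s + 1 + A + B) - int m * int (n + 2))) =
      (of_nat L)\<^sup>2 / (2 * of_nat (n + 2)) + (1 / 2 + (1 - of_nat (s + 1 + A + B)) / of_nat (n + 2)) * of_nat L
      + (r (L mod (n + 2)) :: rat)"
    using sum_tri_quasipolynomial[of "n + 2" "s + 1 + A + B"] assms by auto
  have n: "1 \<le> n" using assms by simp
  show ?thesis
  proof (intro exI allI)
    fix L
    have "(of_nat (card {(m, a, b). a < m + A \<and> b < m + B \<and> m * n + s + 1 + a + b = L}) :: rat) =
        of_int (int (card {(m, a, b). a < m + A \<and> b < m + B \<and> m * n + s + 1 + a + b = L}))"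
      by simp
    also have "\<dots> = of_int (\<Sum>m\<le>L. tri (int L - int (s + 1) - int m * int n)) -
      of_int (\<Sum>m\<le>L. tri (int L - int (s + 1 + A) - int m * int (n + 1))) -
      of_int (\<Sum>m\<le>L. tri (int L - int (s + 1 + B) - int m * int (n + 1))) +
      of_int (\<Sum>m\<le>L. tri (int L - int (s + 1 + A + B) - int m * int (n + 2)))"
      unfolding card_triples[OF n] by (simp only: of_int_add of_int_diff)
    also have "\<dots> =
      (1 / (2 * of_nat n) - 1 / of_nat (n + 1) + 1 / (2 * of_nat (n + 2))) * (of_nat L)\<^sup>2 +
      (- of_nat s / of_nat n + of_nat (2 * s + A + B) / of_nat (n + 1)
        - of_nat (s + A + B) / of_nat (n + 2)) * of_nat L +
      p (L mod n) + (\<lambda>x. - q1 x - q2 x) (L mod (n + 1)) + r (L mod (n + 2))"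
    proof -
      have e: "1 - of_nat (s + 1 + k) = - (of_nat (s + k) :: rat)" for k by simp
      define x y z :: rat where "x = 1 / of_nat n" and "y = 1 / of_nat (n + 1)" and "z = 1 / of_nat (n + 2)"
      have xyz: "a / of_nat n = a * x" "a / of_nat (n + 1) = a * y" "a / of_nat (n + 2) = a * z"
        "a / (2 * of_nat n) = a * x / 2" "a / (2 * of_nat (n + 1)) = a * y / 2"
        "a / (2 * of_nat (n + 2)) = a * z / 2" for a :: rat
        by (simp_all add: x_def y_def z_def)
      show ?thesis
        unfolding p q1 q2 r xyz by (simp add: algebra_simps)
    qed
    finally show "of_nat (card {(m, a, b). a < m + A \<and> b < m + B \<and> m * n + s + 1 + a + b = L}) =
      (1 / (2 * of_nat n) - 1 / of_nat (n + 1) + 1 / (2 * of_nat (n + 2))) * (of_nat L)\<^sup>2 +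
      (- of_nat s / of_nat n + of_nat (2 * s + A + B) / of_nat (n + 1)
        - of_nat (s + A + B) / of_nat (n + 2)) * of_nat L +
      p (L mod n) + (\<lambda>x. - q1 x - q2 x) (L mod (n + 1)) + r (L mod (n + 2))" .
  qed
qed

section \<open>The number of balanced words of a given length\<close>

lemma evenly_Cons_zero_iff:
  assumes "set g \<subseteq> {0, 1}" "evenly g"
  shows "evenly (0 # g) \<longleftrightarrow>
    (\<forall>j k. j + Suc k \<le> length g \<longrightarrow> psum g (j + Suc k) \<le> psum g k + psum g j + 1)"
proof -
  have "evenly (0 # g) \<longleftrightarrow> evenly (1 # flip_word g)"
    using evenly_flip_word[of "0 # g"] evenly_flip_word[of "1 # flip_word g"]
      flip_word_flip_word[of "0 # g"] set_flip_word[OF assms(1)] assms(1)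
    by (auto simp: flip_word_def)
  also have "\<dots> \<longleftrightarrow> (\<forall>j k. j + Suc k \<le> length g \<longrightarrow>
      psum (flip_word g) k + psum (flip_word g) j \<le> psum (flip_word g) (j + Suc k))"
    using evenly_Cons_one_iff[OF set_flip_word[OF assms(1)] evenly_flip_word[OF assms]]
    by (simp add: length_flip_word)
  also have "\<dots> \<longleftrightarrow>
    (\<forall>j k. j + Suc k \<le> length g \<longrightarrow> psum g (j + Suc k) \<le> psum g k + psum g j + 1)"
  proof -
    have "psum (flip_word g) k + psum (flip_word g) j \<le> psum (flip_word g) (j + Suc k) \<longleftrightarrow>
        psum g (j + Suc k) \<le> psum g k + psum g j + 1" if "j + Suc k \<le> length g" for j k
      using psum_flip_word[OF assms(1), of j] psum_flip_word[OF assms(1), of k]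
        psum_flip_word[OF assms(1), of "j + Suc k"] that
      by linarith
    then show ?thesis by blast
  qed
  finally show ?thesis .
qed

text \<open>An obstruction to 0 is a window of length \<open>k + 1\<close> at least 2 heavier than
  the prefix of length \<open>k\<close>; one to 1 is a window of length \<open>l + 1\<close> lighter
  than the prefix of length \<open>l\<close>. Cutting the longer window at the length of the shorter
  and comparing the pieces, the rest with a factor of the longer prefix, contradicts
  balance.\<close>

lemma evenly_extend_left:
  assumes "set g \<subseteq> {0, 1}" "evenly g"
  shows "evenly (0 # g) \<or> evenly (1 # g)"
proof (rule ccontr)
  assume "\<not> ?thesis"
  then obtain s k t l
    where s: "s + Suc k \<le> length g" "psum g (s + Suc k) > psum g k + psum g s + 1"
      and t: "t + Suc l \<le> length g" "psum g l + psum g t > psum g (t + Suc l)"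
    using evenly_Cons_zero_iff[OF assms] evenly_Cons_one_iff[OF assms] by (meson not_le)
  consider "k = l" | d where "k = l + Suc d" | d where "l = k + Suc d"
    by (metis add_Suc_right less_imp_Suc_add linorder_neqE_nat)
  then show False
  proof cases
    case 1
    then show False using evenlyD[OF assms(2), of s "Suc l" t] s t by simp
  next
    case (2 d)
    then show False
      using evenlyD[OF assms(2), of s "Suc l" t] evenlyD[OF assms(2), of "s + Suc l" "Suc d" l] s t
      by (simp add: add_ac)
  next
    case (3 d)
    then show False
      using evenlyD[OF assms(2), of s "Suc k" t] evenlyD[OF assms(2), of k "Suc d" "t + Suc k"] s t
      by (simp add: add_ac)
  qed
qed

section \<open>Left special words and Farey fractions\<close>

definition left_specials :: "nat \<Rightarrow> nat list set" where
  "left_specials n = {u \<in> even_words n. evenly (0 # u) \<and> evenly (1 # u)}"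

lemma card_even_words_Suc_split:
  "card (even_words (Suc n)) =
     card {u \<in> even_words n. evenly (0 # u)} + card {u \<in> even_words n. evenly (1 # u)}"
proof -
  have "even_words (Suc n) = (#) 0 ` {u \<in> even_words n. evenly (0 # u)} \<union>
      (#) 1 ` {u \<in> even_words n. evenly (1 # u)}"
    (is "?E = ?A \<union> ?B")
  proof (intro equalityI subsetI)
    fix w assume "w \<in> ?E"
    then have w: "set w \<subseteq> {0, 1}" "length w = Suc n" "evenly w" using even_wordsD by blast+
    then obtain x u where "w = x # u" by (cases w) auto
    then show "w \<in> ?A \<union> ?B"
      using w evenly_Cons_right[of x u] by (auto simp: even_words_def binaries_def)
  qed (auto simp: even_words_def binaries_def)
  moreover have "?A \<inter> ?B = {}" by auto
  moreover have "finite ?A" "finite ?B" using finite_even_words by auto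
  ultimately show ?thesis by (simp add: card_Un_disjoint card_image)
qed

text \<open>Every balanced word extends to the left, and exactly the left special ones do so in two
  ways.\<close>

lemma card_even_words_Suc:
  "card (even_words (Suc n)) = card (even_words n) + card (left_specials n)"
proof -
  let ?A = "{u \<in> even_words n. evenly (0 # u)}" and ?B = "{u \<in> even_words n. evenly (1 # u)}"
  have "card ?A + card ?B = card (?A \<union> ?B) + card (?A \<inter> ?B)"
    using finite_even_words by (intro card_Un_Int) auto
  moreover have "?A \<union> ?B = even_words n"
    using evenly_extend_left[OF even_wordsD(1,3)] by blast
  moreover have "?A \<inter> ?B = left_specials n" by (auto simp: left_specials_def)
  ultimately show ?thesis by (simp add: card_even_words_Suc_split)
qed

text \<open>Reduced fractions \<open>p / q\<close> in [0, 1), denominator first; 0 is the pair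
  \<open>(1, 0)\<close>, in accordance with \<open>totient 1 = 1\<close>.\<close>

definition farey :: "nat \<Rightarrow> (nat \<times> nat) set" where
  "farey N = (SIGMA q:{1..N}. {p. p < q \<and> coprime p q})"

lemma card_farey: "card (farey N) = (\<Sum>q = 1..N. totient q)"
proof -
  have "card {p. p < q \<and> coprime p q} = totient q" if "1 \<le> q" for q
  proof (cases "q = 1")
    case True
    then have "{p. p < q \<and> coprime p q} = {0}" by auto
    then show ?thesis using True by simp
  next
    case False
    then have "{p. p < q \<and> coprime p q} = totatives q"
      using that by (auto simp: totatives_def order_le_less intro!: Nat.gr0I)
    then show ?thesis by (simp add: totient_def)
  qed
  then show ?thesis by (simp add: farey_def)
qed

text \<open>Differences of the floors of \<open>a * p / q\<close> from \<open>a = 1\<close> on; as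
  the first floor is 0 for \<open>p < q\<close>, the prefix sum of length \<open>i\<close> is the
  floor at \<open>i + 1\<close>.\<close>

definition mechanical :: "nat \<Rightarrow> nat \<times> nat \<Rightarrow> nat list" where
  "mechanical n = (\<lambda>(q, p). map (\<lambda>i. (i + 2) * p div q - (i + 1) * p div q) [0..<n])"

lemma floor_add:
  "a * p div q + b * p div q \<le> (a + b) * p div (q :: nat)"
  "(a + b) * p div q \<le> a * p div q + b * p div q + 1"
proof -
  have eq: "(a + b) * p div q = a * p div q + b * p div q + (a * p mod q + b * p mod q) div q"
    unfolding add_mult_distrib by (rule div_add1_eq)
  then show "a * p div q + b * p div q \<le> (a + b) * p div q" by simp
  have "(a * p mod q + b * p mod q) div q \<le> 1"
  proof (cases "q = 0")
    case False
    then have "a * p mod q + b * p mod q < 2 * q"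
      using mod_less_divisor[of q "a * p"] mod_less_divisor[of q "b * p"] by linarith
    then show ?thesis by (simp add: less_mult_imp_div_less less_Suc_eq_le[symmetric])
  qed simp
  then show "(a + b) * p div q \<le> a * p div q + b * p div q + 1" using eq by simp
qed

lemma psum_mechanical:
  assumes "p < q" "i \<le> n"
  shows "psum (mechanical n (q, p)) i = (i + 1) * p div q"
  using assms(2)
proof (induction i)
  case (Suc i)
  have "(i + 1) * p div q \<le> (i + 2) * p div q" by (intro div_le_mono) simp
  then show ?case
    using Suc by (simp add: mechanical_def take_Suc_conv_app_nth)
qed (use assms in simp)

text \<open>Superadditivity of the floors allows the extension by 1, and their subadditivity up to 1
  the extension by 0; the two together give balance of the word itself.\<close>

lemma mechanical_left_special:
  assumes "p < q"
  shows "mechanical n (q, p) \<in> left_specials n"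
proof -
  let ?u = "mechanical n (q, p)"
  define F where "F a = a * p div q" for a
  have lower: "F a + F b \<le> F (a + b)" and upper: "F (a + b) \<le> F a + F b + 1" for a b
    using floor_add unfolding F_def by blast+
  have F1: "F 1 = 0" using assms by (simp add: F_def)
  have len: "length ?u = n" by (simp add: mechanical_def)
  have ps: "psum ?u i = F (Suc i)" if "i \<le> n" for i
    using psum_mechanical[OF assms that] by (simp add: F_def)
  have set: "set ?u \<subseteq> {0, 1}"
  proof -
    have "F (i + 2) - F (i + 1) \<le> 1" for i
      using upper[of "i + 1" 1] F1 by simp
    then have "F (i + 2) - F (i + 1) \<in> {0, 1}" for i
      by (metis One_nat_def insertCI le_Suc_eq le_zero_eq)
    moreover have "?u = map (\<lambda>i. F (i + 2) - F (i + 1)) [0..<n]"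
      by (simp add: mechanical_def F_def)
    ultimately show ?thesis by (simp only: set_map image_subset_iff) blast
  qed
  have ev: "evenly ?u"
    unfolding evenly_def
  proof (intro allI impI)
    fix i j k assume "i + k \<le> length ?u" "j + k \<le> length ?u"
    then show "psum ?u (i + k) + psum ?u j \<le> psum ?u (j + k) + psum ?u i + 1"
      using upper[of "Suc i" k] lower[of "Suc j" k] by (simp add: ps len)
  qed
  have "evenly (0 # ?u)"
    unfolding evenly_Cons_zero_iff[OF set ev]
  proof (intro allI impI)
    fix j k assume "j + Suc k \<le> length ?u"
    then show "psum ?u (j + Suc k) \<le> psum ?u k + psum ?u j + 1"
      using upper[of "Suc j" "Suc k"] by (simp add: ps len)
  qed
  moreover have "evenly (1 # ?u)"
    unfolding evenly_Cons_one_iff[OF set ev]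
  proof (intro allI impI)
    fix j k assume "j + Suc k \<le> length ?u"
    then show "psum ?u k + psum ?u j \<le> psum ?u (j + Suc k)"
      using lower[of "Suc j" "Suc k"] by (simp add: ps len)
  qed
  ultimately show ?thesis
    using set ev by (simp add: left_specials_def even_words_def binaries_def len)
qed

text \<open>The slope comparison behind the existence of a common line, by the Euclidean algorithm on
  \<open>(a, b)\<close>.\<close>

lemma superadditive_slope_less:
  fixes H :: "nat \<Rightarrow> nat"
  assumes lower: "\<And>a b. 1 \<le> a \<Longrightarrow> 1 \<le> b \<Longrightarrow> a + b \<le> N \<Longrightarrow> H a + H b \<le> H (a + b)"
    and upper: "\<And>a b. 1 \<le> a \<Longrightarrow> 1 \<le> b \<Longrightarrow> a + b \<le> N \<Longrightarrow> H (a + b) \<le> H a + H b + 1"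
    and "1 \<le> a" "a \<le> N" "1 \<le> b" "b \<le> N"
  shows "b * H a < a * (H b + 1)"
  using assms(3-)
proof (induction "a + b" arbitrary: a b rule: less_induct)
  case less
  consider "a = b" | d where "a = d + b" "1 \<le> d" | d where "b = d + a" "1 \<le> d"
    by (metis add.commute less_imp_add_positive linorder_neqE_nat One_nat_def Suc_leI)
  then show ?case
  proof cases
    case 1
    then show ?thesis using less.prems by simp
  next
    case (2 d)
    have "b * H d < d * (H b + 1)" using less 2 by simp
    moreover have "b * H a \<le> b * (H d + H b + 1)"
      using upper[of d b] less.prems 2 by (intro mult_le_mono2) simp
    ultimately show ?thesis unfolding 2 by (simp add: algebra_simps)
  next
    case (3 d)
    have "d * H a < a * (H d + 1)" using less 3 by simp
    moreover have "a * (H d + H a) \<le> a * H b"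
      using lower[of d a] less.prems 3 by (intro mult_le_mono2) simp
    ultimately show ?thesis unfolding 3 by (simp add: algebra_simps)
  qed
qed

text \<open>The two extensions make \<open>H\<close> superadditive up to 1. Let \<open>p / q\<close>
  be the largest slope \<open>H a / a\<close> in lowest terms: maximality gives
  \<open>H a \<le> a * p / q\<close>, and \<open>superadditive_slope_less\<close> gives
  \<open>a * p / q < H a + 1\<close>, so \<open>H a\<close> is the floor.\<close>

lemma left_special_mechanical:
  assumes "u \<in> left_specials n"
  obtains p q where "p < q" "q \<le> Suc n" "coprime p q" "u = mechanical n (q, p)"
proof -
  define N where "N = Suc n"
  define H where "H a = psum u (a - 1)" for a
  have u: "set u \<subseteq> {0, 1}" "length u = n" "evenly u" "evenly (0 # u)" "evenly (1 # u)"
    using assms by (auto simp: left_specials_def even_words_def binaries_def)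
  have lower: "H a + H b \<le> H (a + b)" and upper: "H (a + b) \<le> H a + H b + 1"
    if "1 \<le> a" "1 \<le> b" "a + b \<le> N" for a b
  proof -
    obtain j k where jk: "a = Suc j" "b = Suc k" using \<open>1 \<le> a\<close> \<open>1 \<le> b\<close>
      by (metis One_nat_def Suc_le_D)
    then have le: "j + Suc k \<le> length u" using that u by (simp add: N_def)
    show "H a + H b \<le> H (a + b)"
      using iffD1[OF evenly_Cons_one_iff[OF u(1,3)] u(5)] le jk by (simp add: H_def add.commute)
    show "H (a + b) \<le> H a + H b + 1"
      using iffD1[OF evenly_Cons_zero_iff[OF u(1,3)] u(4)] le jk by (simp add: H_def add.commute)
  qed
  define slope where "slope a = (of_nat (H a) / of_nat a :: rat)" for a
  have "Max (slope ` {1..N}) \<in> slope ` {1..N}"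
    by (rule Max_in) (auto simp: N_def)
  then obtain q0 where q0: "q0 \<in> {1..N}" "slope q0 = Max (slope ` {1..N})" by auto
  have max: "H a * q0 \<le> H q0 * a" if "a \<in> {1..N}" for a
  proof -
    have "slope a \<le> slope q0" unfolding q0(2) using that by simp
    then have "(of_nat (H a * q0) :: rat) \<le> of_nat (H q0 * a)"
      using that q0(1) by (simp add: slope_def field_simps)
    then show ?thesis unfolding of_nat_le_iff .
  qed
  have H: "H a = a * H q0 div q0" if "a \<in> {1..N}" for a
  proof (rule div_nat_eqI[symmetric])
    show "q0 * H a \<le> a * H q0" using max[OF that] by (simp add: mult.commute)
    have "a * H q0 < q0 * (H a + 1)"
      using superadditive_slope_less[of N H q0 a] lower upper that q0(1) by simp
    then show "a * H q0 < q0 * Suc (H a)" by simp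
  qed
  define d where "d = gcd (H q0) q0"
  define p where "p = H q0 div d"
  define q where "q = q0 div d"
  have d: "0 < d" using q0(1) by (simp add: d_def)
  have pq: "H q0 = p * d" "q0 = q * d" by (simp_all add: p_def q_def d_def)
  have "coprime p q"
    unfolding p_def q_def d_def by (rule div_gcd_coprime) (use q0(1) in auto)
  moreover have "p < q"
  proof -
    have "psum u i \<le> i" for i
      using psum_Suc_le[OF u(1)] by (induction i) (auto intro: le_trans)
    then have "H q0 < q0" using q0(1) by (metis H_def One_nat_def Suc_le_lessD Suc_pred
          atLeastAtMost_iff le_imp_less_Suc)
    then show ?thesis using pq d by simp
  qed
  moreover have "q \<le> Suc n"
    using q0(1) pq(2) d by (metis N_def atLeastAtMost_iff div_le_dividend le_trans q_def)
  moreover have Hpq: "H a = a * p div q" if "a \<in> {1..N}" for a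
  proof -
    have "H a = a * (p * d) div q0" using H[OF that] unfolding pq(1) .
    also have "\<dots> = (a * p * d) div (q * d)" by (simp only: pq(2) mult.assoc)
    finally show ?thesis using d by simp
  qed
  have "u = mechanical n (q, p)"
  proof (rule nth_equalityI)
    fix i assume "i < length u"
    then have i: "i < n" using u by simp
    have "psum u (Suc i) = psum u i + u ! i"
      using i u by (simp add: take_Suc_conv_app_nth)
    then have "u ! i = H (i + 2) - H (i + 1)" by (simp add: H_def)
    also have "\<dots> = (i + 2) * p div q - (i + 1) * p div q"
      using Hpq i by (simp add: N_def)
    finally show "u ! i = mechanical n (q, p) ! i" using i by (simp add: mechanical_def)
  qed (simp add: mechanical_def u)
  ultimately show thesis using that by blast
qed

lemma card_left_specials: "card (left_specials n) = (\<Sum>q = 1..Suc n. totient q)"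
proof -
  have "bij_betw (mechanical n) (farey (Suc n)) (left_specials n)"
    unfolding bij_betw_def
  proof
    show "inj_on (mechanical n) (farey (Suc n))"
    proof (rule inj_onI, clarify)
      fix q p q' p' assume x: "(q, p) \<in> farey (Suc n)" and y: "(q', p') \<in> farey (Suc n)"
        and eq: "mechanical n (q, p) = mechanical n (q', p')"
      have pq: "1 \<le> q" "q \<le> Suc n" "p < q" "coprime p q"
        and pq': "1 \<le> q'" "q' \<le> Suc n" "p' < q'" "coprime p' q'"
        using x y by (auto simp: farey_def)
      have floors: "a * p div q = a * p' div q'" if "1 \<le> a" "a \<le> Suc n" for a
        using psum_mechanical[OF pq(3), of "a - 1" n] psum_mechanical[OF pq'(3), of "a - 1" n]
          eq that by simp
      \<comment> \<open>Evaluating the common floors at each denominator bounds either fraction by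
        the other.\<close>
      have "p = q * p' div q'" using floors[of q] pq by simp
      then have 1: "p * q' \<le> q * p'" by (metis div_times_less_eq_dividend)
      have "p' = q' * p div q" using floors[of q'] pq' by simp
      then have 2: "p' * q \<le> q' * p" by (metis div_times_less_eq_dividend)
      have "p * q' = p' * q" using 1 2 by (simp add: mult.commute)
      then show "q = q' \<and> p = p'"
        using coprime_crossproduct_nat[of p q p' q'] pq(4) pq'(4) by simp
    qed
    show "mechanical n ` farey (Suc n) = left_specials n"
    proof (intro equalityI subsetI)
      fix u assume "u \<in> left_specials n"
      then obtain p q where "p < q" "q \<le> Suc n" "coprime p q" "u = mechanical n (q, p)"
        by (rule left_special_mechanical)
      then show "u \<in> mechanical n ` farey (Suc n)"
        by (intro image_eqI[of _ _ "(q, p)"]) (auto simp: farey_def)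
    qed (auto simp: farey_def mechanical_left_special)
  qed
  then show ?thesis using bij_betw_same_card card_farey by metis
qed

text \<open>Summation of the increments: \<open>totient i\<close> enters when length
  \<open>i\<close> is reached and again at each later length up to \<open>n\<close>.\<close>

lemma card_even_words: "card (even_words n) = 1 + (\<Sum>i = 1..n. (n + 1 - i) * totient i)"
proof (induction n)
  case 0
  have "even_words 0 = {[]}" by (auto simp: even_words_def binaries_def evenly_def)
  then show ?case by simp
next
  case (Suc n)
  have "(\<Sum>i = 1..Suc n. (Suc n + 1 - i) * totient i) =
      (\<Sum>i = 1..Suc n. (n + 1 - i) * totient i + totient i)"
    by (intro sum.cong) (auto simp: Suc_diff_le algebra_simps)
  then show ?case
    using Suc by (simp add: card_even_words_Suc card_left_specials sum.distrib)
qed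

section \<open>The quasi-polynomial\<close>

lemma flip_word_Cons_append:
  "flip_word (x # u) = (1 - x) # flip_word u" "flip_word (u @ [x]) = flip_word u @ [1 - x]"
  by (simp_all add: flip_word_def)

lemma card_even_words_extensions_flip:
  "card {u \<in> even_words n. evenly (0 # u)} = card {u \<in> even_words n. evenly (1 # u)}"
  "card {u \<in> even_words n. evenly (u @ [0])} = card {u \<in> even_words n. evenly (u @ [1])}"
proof -
  have flips: "evenly (1 # flip_word u)" if "evenly (0 # u)" "set u \<subseteq> {0, 1}" for u
    using evenly_flip_word[of "0 # u"] that by (simp add: flip_word_Cons_append)
  have flips': "evenly (0 # flip_word u)" if "evenly (1 # u)" "set u \<subseteq> {0, 1}" for u
    using evenly_flip_word[of "1 # u"] that by (simp add: flip_word_Cons_append)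
  have snoc: "evenly (flip_word u @ [1])" if "evenly (u @ [0])" "set u \<subseteq> {0, 1}" for u
    using evenly_flip_word[of "u @ [0]"] that by (simp add: flip_word_Cons_append)
  have snoc': "evenly (flip_word u @ [0])" if "evenly (u @ [1])" "set u \<subseteq> {0, 1}" for u
    using evenly_flip_word[of "u @ [1]"] that by (simp add: flip_word_Cons_append)
  show "card {u \<in> even_words n. evenly (0 # u)} = card {u \<in> even_words n. evenly (1 # u)}"
    by (rule bij_betw_same_card[OF bij_betw_byWitness[where f = flip_word and f' = flip_word]])
      (use flips flips' flip_word_even_words flip_word_flip_word even_wordsD(1) in blast)+
  show "card {u \<in> even_words n. evenly (u @ [0])} = card {u \<in> even_words n. evenly (u @ [1])}"
    by (rule bij_betw_same_card[OF bij_betw_byWitness[where f = flip_word and f' = flip_word]])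
      (use snoc snoc' flip_word_even_words flip_word_flip_word even_wordsD(1) in blast)+
qed

lemma card_even_words_Suc_split_right:
  "card (even_words (Suc n)) =
     card {u \<in> even_words n. evenly (u @ [0])} + card {u \<in> even_words n. evenly (u @ [1])}"
proof -
  have "even_words (Suc n) = (\<lambda>u. u @ [0]) ` {u \<in> even_words n. evenly (u @ [0])} \<union>
      (\<lambda>u. u @ [1]) ` {u \<in> even_words n. evenly (u @ [1])}"
    (is "?E = ?A \<union> ?B")
  proof (intro equalityI subsetI)
    fix w assume "w \<in> ?E"
    then have w: "set w \<subseteq> {0, 1}" "length w = Suc n" "evenly w" using even_wordsD by blast+
    then obtain x u where "w = u @ [x]" by (cases w rule: rev_cases) auto
    then show "w \<in> ?A \<union> ?B"
      using w evenly_append_left[of u "[x]"] by (auto simp: even_words_def binaries_def)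
  qed (auto simp: even_words_def binaries_def)
  moreover have "?A \<inter> ?B = {}" by auto
  moreover have "finite ?A" "finite ?B" using finite_even_words by auto
  ultimately show ?thesis by (simp add: card_Un_disjoint card_image inj_on_def)
qed

lemma evenly_replicate: "evenly (replicate n 1)"
  by (simp add: evenly_def sum_list_replicate)

lemma even_words_eq_insert:
  "even_words n = insert (replicate n 1) (gap_words n)" "replicate n 1 \<notin> gap_words n"
proof -
  have "w = replicate n 1" if "set w \<subseteq> {0, 1}" "length w = n" "\<not> sum_list w < n" for w
    using that
  proof (induction w arbitrary: n)
    case (Cons x w)
    have "sum_list w \<le> length w" using binary_sum_list(2)[of w] Cons.prems by simp
    then show ?case using Cons by auto
  qed simp
  then have "w = replicate n 1 \<or> w \<in> gap_words n" if "w \<in> even_words n" for w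
    using even_wordsD[OF that] that unfolding gap_words_def by blast
  moreover have "replicate n 1 \<in> even_words n"
    using evenly_replicate[of n] by (auto simp: even_words_def binaries_def)
  moreover have "gap_words n \<subseteq> even_words n" unfolding gap_words_def by blast
  ultimately show "even_words n = insert (replicate n 1) (gap_words n)" by blast
  show "replicate n 1 \<notin> gap_words n" by (simp add: gap_words_def sum_list_replicate)
qed

lemma finite_gap_words: "finite (gap_words n)"
  using finite_even_words by (simp add: gap_words_def)

lemma sum_even_words:
  fixes f :: "nat list \<Rightarrow> nat"
  shows "sum f (even_words n) = f (replicate n 1) + sum f (gap_words n)"
  unfolding even_words_eq_insert(1) using finite_gap_words even_words_eq_insert(2) by simp

lemma card_gap_words: "card (gap_words n) = (\<Sum>i = 1..n. (n + 1 - i) * totient i)"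
  using card_even_words[of n] sum_even_words[of "\<lambda>_. 1" n] by simp

text \<open>Complementation permutes the balanced words, so their mean height is
  \<open>n / 2\<close>; the all-ones word, of height \<open>n\<close>, is then removed.\<close>

lemma sum_heights_gap_words:
  "2 * (\<Sum>g\<in>gap_words n. sum_list g) + n = n * card (gap_words n)"
proof -
  have "(\<Sum>g\<in>even_words n. sum_list g) = (\<Sum>g\<in>even_words n. sum_list (flip_word g))"
    using sum.reindex_bij_betw[OF bij_betw_flip_word, of sum_list n] by simp
  then have "2 * (\<Sum>g\<in>even_words n. sum_list g) =
      (\<Sum>g\<in>even_words n. sum_list (flip_word g) + sum_list g)"
    by (simp add: sum.distrib)
  also have "\<dots> = (\<Sum>g\<in>even_words n. n)"
    using sum_list_flip_word even_wordsD by (intro sum.cong) auto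
  finally have "2 * (\<Sum>g\<in>even_words n. sum_list g) = card (even_words n) * n" by simp
  moreover have "card (even_words n) = Suc (card (gap_words n))"
    using sum_even_words[of "\<lambda>_. 1" n] by simp
  ultimately show ?thesis
    using sum_even_words[of sum_list n] by (simp add: sum_list_replicate mult.commute)
qed

text \<open>By complementation half of the balanced words of length \<open>n + 1\<close> begin with
  1, and half end with 1. So the left and right extensions by 1 together number
  \<open>card (even_words (Suc n))\<close>; the all-ones word accounts for two of them.\<close>

lemma sum_extensions_gap_words:
  "(\<Sum>g\<in>gap_words n. lext g + rext g) + 1 =
     card (gap_words n) + (\<Sum>i = 1..Suc n. totient i)"
proof -
  have "(\<Sum>g\<in>even_words n. lext g) = card {u \<in> even_words n. evenly (1 # u)}"
    "(\<Sum>g\<in>even_words n. rext g) = card {u \<in> even_words n. evenly (u @ [1])}"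
    using finite_even_words by (simp_all add: sum_of_bool_eq Int_def)
  then have "2 * (\<Sum>g\<in>even_words n. lext g) = card (even_words (Suc n))"
    "2 * (\<Sum>g\<in>even_words n. rext g) = card (even_words (Suc n))"
    using card_even_words_Suc_split[of n] card_even_words_Suc_split_right[of n]
      card_even_words_extensions_flip[of n] by linarith+
  then have "(\<Sum>g\<in>even_words n. lext g) + (\<Sum>g\<in>even_words n. rext g) = card (even_words (Suc n))"
    by simp
  moreover have "lext (replicate n 1) = 1" "rext (replicate n 1) = 1"
    using evenly_replicate[of "Suc n"] by (simp_all add: replicate_append_same)
  moreover have "card (even_words n) = Suc (card (gap_words n))"
    using sum_even_words[of "\<lambda>_. 1" n] by simp
  ultimately show ?thesis
    using sum_even_words[of lext n] sum_even_words[of rext n]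
    unfolding card_even_words_Suc card_left_specials sum.distrib by linarith
qed

section \<open>Summation over all gap words\<close>

lemma card_gap_data:
  assumes "1 \<le> n"
  shows "card (gap_data n L) = (\<Sum>g\<in>gap_words n. card {(m, a, b).
    a < m + lext g \<and> b < m + rext g \<and> m * n + sum_list g + 1 + a + b = L})"
  unfolding gap_data_def
  using finite_gap_words finite_triples[OF assms] by (intro card_SigmaI) auto

lemma partial_fractions:
  fixes k :: rat
  assumes "0 < k"
  shows "1 / k / 2 - 1 / (k + 1) + 1 / (k + 2) / 2 = 1 / (k * (k + 1) * (k + 2))"
    "2 * (1 / (k + 1)) - 1 / k - 1 / (k + 2) = - (2 * (1 / (k * (k + 1) * (k + 2))))"
    "1 / (k + 1) - 1 / (k + 2) = 1 / ((k + 1) * (k + 2))"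
proof -
  have nz: "k \<noteq> 0" "k + 1 \<noteq> 0" "k + 2 \<noteq> 0" using assms by auto
  show "1 / (k + 1) - 1 / (k + 2) = 1 / ((k + 1) * (k + 2))"
    using nz by (simp add: divide_simps)
  show 2: "2 * (1 / (k + 1)) - 1 / k - 1 / (k + 2) = - (2 * (1 / (k * (k + 1) * (k + 2))))"
    using nz by (simp add: divide_simps) (simp add: algebra_simps)
  have "a / 2 - b + c / 2 = d" if "2 * b - a - c = - (2 * d)" for a b c d :: rat
    using that by linarith
  from this[OF 2] show "1 / k / 2 - 1 / (k + 1) + 1 / (k + 2) / 2 = 1 / (k * (k + 1) * (k + 2))" .
qed

lemma sum_quadratic:
  fixes s e p q r :: "'a \<Rightarrow> rat"
  shows "(\<Sum>g\<in>A. a * x + (b * s g + c * e g) * y + p g + q g + r g) =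
    of_nat (card A) * a * x + (b * sum s A + c * sum e A) * y + sum p A + sum q A + sum r A"
  by (induction A rule: infinite_finite_induct) (simp_all add: algebra_simps)

text \<open>For each \<open>g\<close> the quadratic coefficient is constant and the linear one is a
  combination of the height and the number of extensions by 1. Only the totals of these two
  quantities are therefore needed.\<close>

lemma card_gap_data_quasipolynomial:
  assumes "1 \<le> n"
  shows "\<exists>u v w :: nat \<Rightarrow> rat. \<forall>L. of_nat (card (gap_data n L)) =
    of_nat (card (gap_words n)) / (of_nat n * of_nat (n + 1) * of_nat (n + 2)) * (of_nat L)\<^sup>2 +
    of_nat (\<Sum>i = 1..Suc n. totient i) / (of_nat (n + 1) * of_nat (n + 2)) * of_nat L +
    u (L mod n) + v (L mod (n + 1)) + w (L mod (n + 2))"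
proof -
  let ?T = "\<lambda>g L. {(m, a, b). a < m + lext g \<and> b < m + rext g \<and>
      m * n + sum_list g + 1 + a + b = L}"
  define x y z :: rat where xyz: "x = 1 / of_nat n" "y = 1 / of_nat (n + 1)" "z = 1 / of_nat (n + 2)"
  define M S E \<Phi> :: rat where "M = of_nat (card (gap_words n))"
    and "S = of_nat (\<Sum>g\<in>gap_words n. sum_list g)"
    and "E = of_nat (\<Sum>g\<in>gap_words n. lext g + rext g)"
    and "\<Phi> = of_nat (\<Sum>i = 1..Suc n. totient i)"
  note MSE = this
  define Q where "Q g p q r \<longleftrightarrow> (\<forall>L. of_nat (card (?T g L)) =
      (x / 2 - y + z / 2) * (of_nat L)\<^sup>2 +
      ((2 * y - x - z) * of_nat (sum_list g) + (y - z) * of_nat (lext g + rext g)) * of_nat L +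
      p (L mod n) + q (L mod (n + 1)) + r (L mod (n + 2)))"
    for g and p q r :: "nat \<Rightarrow> rat"
  have "\<exists>p q r. Q g p q r" if "g \<in> gap_words n" for g
  proof -
    have divs: "a / of_nat n = a * x" "a / of_nat (n + 1) = a * y" "a / of_nat (n + 2) = a * z" for a
      by (simp_all add: xyz)
    have c1: "1 / (2 * of_nat n) - 1 / of_nat (n + 1) + 1 / (2 * of_nat (n + 2)) = x / 2 - y + z / 2"
      by (simp add: xyz mult.commute)
    have c2: "- of_nat s / of_nat n + of_nat (2 * s + A + B) / of_nat (n + 1)
        - of_nat (s + A + B) / of_nat (n + 2) =
        (2 * y - x - z) * of_nat s + (y - z) * of_nat (A + B)" for s A B
      unfolding divs by (simp add: algebra_simps)
    have "sum_list g < n" "lext g \<le> 1" "rext g \<le> 1"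
      using that by (simp_all add: gap_words_def)
    from card_triples_quasipolynomial[OF this] show ?thesis unfolding Q_def c1 c2 .
  qed
  then obtain p q r where "\<And>g. g \<in> gap_words n \<Longrightarrow> Q g (p g) (q g) (r g)" by metis
  then have pqr: "of_nat (card (?T g L)) =
      (x / 2 - y + z / 2) * (of_nat L)\<^sup>2 +
      ((2 * y - x - z) * of_nat (sum_list g) + (y - z) * of_nat (lext g + rext g)) * of_nat L +
      p g (L mod n) + q g (L mod (n + 1)) + r g (L mod (n + 2))" if "g \<in> gap_words n" for g L
    using that unfolding Q_def by blast
  define k :: rat where "k = of_nat n"
  have k: "0 < k" "of_nat n = k" "of_nat (n + 1) = k + 1" "of_nat (n + 2) = k + 2"
    using assms by (simp_all add: k_def)
  have alpha: "M * (x / 2 - y + z / 2) = M / (of_nat n * of_nat (n + 1) * of_nat (n + 2))"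
    unfolding xyz k(2-4) partial_fractions(1)[OF k(1)] by simp
  have S: "S = of_nat n * (M - 1) / 2"
    using arg_cong[OF sum_heights_gap_words[of n], of "of_nat :: nat \<Rightarrow> rat"]
    by (simp add: MSE field_simps)
  have E: "E = M + \<Phi> - 1"
    using arg_cong[OF sum_extensions_gap_words[of n], of "of_nat :: nat \<Rightarrow> rat"]
    unfolding MSE of_nat_add of_nat_1 by linarith
  \<comment> \<open>With \<open>S = n * (M - 1) / 2\<close> and \<open>E = (M - 1) + \<Phi>\<close>
    the contributions of \<open>M - 1\<close> cancel by the partial fractions.\<close>
  have beta: "(2 * y - x - z) * S + (y - z) * E = \<Phi> / (of_nat (n + 1) * of_nat (n + 2))"
  proof -
    have "(2 * y - x - z) * S = - ((M - 1) / ((k + 1) * (k + 2)))"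
    proof -
      have "- (2 * (1 / (k * a * b))) * (k * c / 2) = - (c / (a * b))" for a b c
        using k(1) by simp
      then show ?thesis unfolding xyz S k(2-4) partial_fractions(2)[OF k(1)] .
    qed
    moreover have "(y - z) * E = (M + \<Phi> - 1) / ((k + 1) * (k + 2))"
      unfolding xyz E k(2-4) partial_fractions(3)[OF k(1)] by simp
    ultimately show ?thesis
      unfolding k(2-4) by (simp add: add_divide_distrib diff_divide_distrib)
  qed
  define U V W where "U i = (\<Sum>g\<in>gap_words n. p g i)"
    and "V i = (\<Sum>g\<in>gap_words n. q g i)" and "W i = (\<Sum>g\<in>gap_words n. r g i)" for i
  note UVW = this
  have "of_nat (card (gap_data n L)) =
      M / (of_nat n * of_nat (n + 1) * of_nat (n + 2)) * (of_nat L)\<^sup>2 +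
      \<Phi> / (of_nat (n + 1) * of_nat (n + 2)) * of_nat L +
      U (L mod n) + V (L mod (n + 1)) + W (L mod (n + 2))" for L
  proof -
    have "of_nat (card (gap_data n L)) = (\<Sum>g\<in>gap_words n. of_nat (card (?T g L)) :: rat)"
      by (simp only: card_gap_data[OF assms] of_nat_sum)
    also have "\<dots> = (\<Sum>g\<in>gap_words n. (x / 2 - y + z / 2) * (of_nat L)\<^sup>2 +
      ((2 * y - x - z) * of_nat (sum_list g) + (y - z) * of_nat (lext g + rext g)) * of_nat L +
      p g (L mod n) + q g (L mod (n + 1)) + r g (L mod (n + 2)))"
      by (rule sum.cong[OF refl pqr])
    also have "\<dots> = M * (x / 2 - y + z / 2) * (of_nat L)\<^sup>2 +
      ((2 * y - x - z) * S + (y - z) * E) * of_nat L +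
      U (L mod n) + V (L mod (n + 1)) + W (L mod (n + 2))"
      unfolding MSE UVW of_nat_sum by (rule sum_quadratic)
    finally show ?thesis unfolding alpha beta .
  qed
  then show ?thesis
    unfolding MSE(1,4) by blast
qed

theorem theorem11:
  fixes h :: nat
  assumes "h \<ge> 2"
  shows "\<exists>(u :: nat \<Rightarrow> rat) (v :: nat \<Rightarrow> rat) (w :: nat \<Rightarrow> rat). \<forall>L :: nat.
    (let \<alpha> = 1 / (of_nat h * ((of_nat h)\<^sup>2 - 1)) *
               (\<Sum>i = 1..h - 1. (of_nat h - of_nat i) * of_nat (totient i));
         \<beta> = 1 / (of_nat h * (of_nat h + 1)) * (\<Sum>i = 1..h. of_nat (totient i))
     in of_nat (num_balanced (int L) (int h)) =
          \<alpha> * (of_nat L)\<^sup>2 + \<beta> * of_nat L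
          + u (L mod (h - 1)) + v (L mod h) + w (L mod (h + 1)))"
proof -
  \<comment> \<open>The number of inner gaps; the periods \<open>n\<close>, \<open>n + 1\<close>,
    \<open>n + 2\<close> become \<open>h - 1\<close>, \<open>h\<close>,
    \<open>h + 1\<close>.\<close>
  obtain n where h: "h = Suc n" and n: "1 \<le> n"
    using assms by (metis One_nat_def Suc_1 Suc_le_D Suc_le_mono)
  obtain u v w :: "nat \<Rightarrow> rat" where uvw: "\<And>L. of_nat (card (gap_data n L)) =
    of_nat (card (gap_words n)) / (of_nat n * of_nat (n + 1) * of_nat (n + 2)) * (of_nat L)\<^sup>2 +
    of_nat (\<Sum>i = 1..Suc n. totient i) / (of_nat (n + 1) * of_nat (n + 2)) * of_nat L +
    u (L mod n) + v (L mod (n + 1)) + w (L mod (n + 2))"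
    using card_gap_data_quasipolynomial[OF n] by blast
  have "(\<Sum>i = 1..h - 1. (of_nat h - of_nat i) * of_nat (totient i)) =
      (of_nat (card (gap_words n)) :: rat)"
    unfolding card_gap_words of_nat_sum by (intro sum.cong) (auto simp: h of_nat_diff)
  moreover have "of_nat h * ((of_nat h)\<^sup>2 - 1) = (of_nat n * of_nat (n + 1) * of_nat (n + 2) :: rat)"
    by (simp add: h power2_eq_square algebra_simps)
  moreover have "of_nat h * (of_nat h + 1) = (of_nat (n + 1) * of_nat (n + 2) :: rat)"
    by (simp add: h algebra_simps)
  moreover have "(\<Sum>i = 1..h. of_nat (totient i)) = (of_nat (\<Sum>i = 1..Suc n. totient i) :: rat)"
    unfolding h of_nat_sum ..
  moreover have "num_balanced (int L) (int h) = card (gap_data n L)" for L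
    unfolding h by (rule num_balanced_eq_card_gap_data[OF n])
  moreover have "L mod (h - 1) = L mod n" "L mod h = L mod (n + 1)" "L mod (h + 1) = L mod (n + 2)"
    for L
    by (simp_all add: h)
  ultimately have "\<forall>L :: nat.
    (let \<alpha> = 1 / (of_nat h * ((of_nat h)\<^sup>2 - 1)) *
               (\<Sum>i = 1..h - 1. (of_nat h - of_nat i) * of_nat (totient i));
         \<beta> = 1 / (of_nat h * (of_nat h + 1)) * (\<Sum>i = 1..h. of_nat (totient i))
     in of_nat (num_balanced (int L) (int h)) =
          \<alpha> * (of_nat L)\<^sup>2 + \<beta> * of_nat L
          + u (L mod (h - 1)) + v (L mod h) + w (L mod (h + 1)))"
    unfolding Let_def by (simp only: uvw times_divide_eq_left mult_1_left simp_thms)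
  then show ?thesis by blast
qed

end
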